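(* For $n\ge 3$ define the rational function $Z_n=\dfrac{\psi_n\gamma_{n-2}}{\gamma_n}$ of $\lambda$, and for $n\ge 1$ let $\zeta_n=\gamma_n/\eta_n$ with $\eta_n=\gamma_{n-1}\prod_{0\le 2j\le n-4}\gamma_{n-2j-3}^{2^j}$. Then for all $n\ge 5$ the function $Z_n$ satisfies the recursion $$Z_n-1=\frac{1}{Z_{n-1}}\Bigl(1-\frac{1}{Z_{n-2}}\Bigr)\Bigl(1-\frac{2}{\zeta_n}\Bigr)\frac{1}{\zeta_{n-2}-2},$$ where the equality is valid at the poles in the usual sense of rational functions in $\lambda$, and the initial data is $$Z_3=\frac{(\lambda^3-10\lambda^2+24\lambda-8)(\lambda-2)}{\lambda^4-12\lambda^3+42\lambda^2-44\lambda+8},$$ $$Z_4=\frac{(\lambda^5-16\lambda^4+88\lambda^3-192\lambda^2+136\lambda-16)(\lambda^2-6\lambda+4)}{\lambda^7-22\lambda^6+186\lambda^5-756\lambda^4+1508\lambda^3-1344\lambda^2+448\lambda-32}.$$ The remaining $\psi_n$ are $\psi_1=\lambda(\lambda-4)$ and $\psi_2=\lambda^2-8\lambda+8$.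
   Context: Graphs are finite undirected multigraphs, loops allowed. Each $G_n$ ($n\ge 0$) has two boundary vertices, forming $\partial G_n$. $G_0$: two vertices joined by one edge, both boundary. $G_1$: a path $a-b-c$ with a loop at $b$, $\partial G_1=\{a,c\}$. For $n\ge2$, $G_n$ is obtained from one copy of $G_{n-1}$ and two copies of $G_{n-2}$ by identifying to a single vertex (the gluing vertex) both boundary vertices of $G_{n-1}$ and one boundary vertex of each copy of $G_{n-2}$; the remaining boundary vertices of the two copies of $G_{n-2}$ form $\partial G_n$. (Each $G_n$ has a reflection swapping its boundary vertices, so choices do not matter.) $\Gamma_0$ is one vertex with two loops; for $n\ge1$, $\Gamma_n$ is obtained from a copy of $G_n$ and a copy of $G_{n-1}$ by identifying all four boundary vertices to a single vertex $u$. For $n\ge2$, $v\in\Gamma_n$ denotes the gluing vertex of the copy of $G_n$. Laplacian of a graph $H$: $\Delta(H)f(x)=\sum_y c_{xy}(f(x)-f(y))$, with $c_{xy}$ the number of edges joining $x,y$ (loops contribute $0$). $\mathrm{Spec}(\Delta(H))$ is its set of eigenvalues. The Dirichlet Laplacian on $G_n$ is the same operator on functions vanishing on $\partial G_n$ (eigenvalue equation imposed at non-boundary vertices; matrix obtained by deleting the rows and columns of $\partial G_n$), with eigenvalue set $\mathrm{DirSpec}(\Delta(G_n))$. $\lambda$ is born at level $n$ for $\Gamma$ if $\lambda\in\mathrm{Spec}(\Delta(\Gamma_n))$ but $\lambda\notin\mathrm{Spec}(\Delta(\Gamma_m))$ for $m<n$; it is born at level $n$ for the Dirichlet spectrum if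 $\lambda\in\mathrm{DirSpec}(\Delta(G_n))$ but $\lambda\notin\mathrm{DirSpec}(\Delta(G_m))$ for $m<n$. An eigenvalue $\lambda$ born at level $n$ for $\Gamma$ is in the 0-series if $n\in\{0,1\}$, or $n\ge2$ and every eigenfunction $f$ of $\Delta(\Gamma_n)$ with eigenvalue $\lambda$ satisfies $f(u)f(v)\ne0$. $\gamma_n$ ($n\ge1$) is the monic polynomial whose roots (all simple) are the Dirichlet eigenvalues born at level $n$ on $G_n$; $\gamma_0=\gamma_{-1}=\gamma_{-2}=1$. $\psi_n$ ($n\ge0$) is the monic polynomial whose roots (all simple) are the 0-series eigenvalues born at level $n$.
   Formalization: The value ψ_1=λ(λ−4) is corrected to ψ_1=λ−4, since 0 is already in Spec(Δ(Γ_0)) and so is born at level 0; it is stated instead that ψ_0ψ_1=λ(λ−4) and that the monic polynomial with simple roots Spec(Δ(Γ_1)) is λ(λ−4). *)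

theory Defs
  imports
    "HOL-Library.Uprod"
    "HOL-Computational_Algebra.Computational_Algebra"
begin

text \<open>A loop at \<open>x\<close> is the unordered pair \<open>Upair x x\<close>.\<close>

record 'a multigraph =
  verts :: "'a set"
  edges :: "'a uprod multiset"

definition edge_count :: "'a multigraph \<Rightarrow> 'a \<Rightarrow> 'a \<Rightarrow> nat" where
  "edge_count H x y = count (edges H) (Upair x y)"

definition laplacian :: "'a multigraph \<Rightarrow> ('a \<Rightarrow> real) \<Rightarrow> 'a \<Rightarrow> real" where
  "laplacian H f x = (\<Sum>y\<in>verts H. real (edge_count H x y) * (f x - f y))"

text \<open>
  Functions on a graph are functions on the whole vertex type whose values outside
  \<open>verts H\<close> play no role; a nonzero function is one that is nonzero somewhere on \<open>verts H\<close>.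
\<close>

definition eigenfunction :: "'a multigraph \<Rightarrow> real \<Rightarrow> ('a \<Rightarrow> real) \<Rightarrow> bool" where
  "eigenfunction H lam f \<longleftrightarrow>
     (\<exists>x\<in>verts H. f x \<noteq> 0) \<and> (\<forall>x\<in>verts H. laplacian H f x = lam * f x)"

definition Spec :: "'a multigraph \<Rightarrow> real set" where
  "Spec H = {lam. \<exists>f. eigenfunction H lam f}"

definition dirichlet_eigenfunction ::
    "'a multigraph \<Rightarrow> 'a set \<Rightarrow> real \<Rightarrow> ('a \<Rightarrow> real) \<Rightarrow> bool" where
  "dirichlet_eigenfunction H B lam f \<longleftrightarrow>
     (\<exists>x\<in>verts H. f x \<noteq> 0) \<and> (\<forall>x\<in>B. f x = 0) \<and>
     (\<forall>x\<in>verts H - B. laplacian H f x = lam * f x)"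

definition DirSpec :: "'a multigraph \<Rightarrow> 'a set \<Rightarrow> real set" where
  "DirSpec H B = {lam. \<exists>f. dirichlet_eigenfunction H B lam f}"

text \<open>
  The boundary vertices of every \<open>G\<^sub>n\<close> are \<open>End False\<close> and \<open>End True\<close>. \<open>Centre\<close> is the middle
  vertex \<open>b\<close> of \<open>G\<^sub>1\<close>, and for \<open>n \<ge> 2\<close> the gluing vertex of \<open>G\<^sub>n\<close>. The non-boundary vertices
  of the three constituent copies are kept apart by the tag in \<open>Inner\<close>: \<open>Big\<close> is the copy of
  \<open>G\<^sub>n\<^sub>-\<^sub>1\<close>, while \<open>Lft\<close> and \<open>Rgt\<close> are the two copies of \<open>G\<^sub>n\<^sub>-\<^sub>2\<close>.
\<close>

datatype part = Big | Lft | Rgt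

datatype vertex = End bool | Centre | Inner part vertex

definition bdry :: "vertex set" where
  "bdry = {End False, End True}"

text \<open>
  \<open>glue p\<close> sends the vertices of the copy \<open>p\<close> to their classes after the identification. It is
  injective except that it sends both boundary vertices of \<open>Big\<close> to the gluing vertex; taking
  images of vertices and edges under these maps therefore forms the glued graph.
\<close>

fun glue :: "part \<Rightarrow> vertex \<Rightarrow> vertex" where
  "glue Big (End b) = Centre"
| "glue Lft (End b) = (if b then Centre else End False)"
| "glue Rgt (End b) = (if b then End True else Centre)"
| "glue p Centre = Inner p Centre"
| "glue p (Inner q x) = Inner p (Inner q x)"

fun G :: "nat \<Rightarrow> vertex multigraph" where
  "G 0 = \<lparr>verts = {End False, End True}, edges = {#Upair (End False) (End True)#}\<rparr>"
| "G (Suc 0) = \<lparr>verts = {End False, Centre, End True},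
     edges = {#Upair (End False) Centre, Upair Centre (End True), Upair Centre Centre#}\<rparr>"
| "G (Suc (Suc n)) = \<lparr>
     verts = glue Big ` verts (G (Suc n)) \<union> glue Lft ` verts (G n) \<union> glue Rgt ` verts (G n),
     edges = image_mset (map_uprod (glue Big)) (edges (G (Suc n)))
       + image_mset (map_uprod (glue Lft)) (edges (G n))
       + image_mset (map_uprod (glue Rgt)) (edges (G n))\<rparr>"

text \<open>\<open>Base\<close> is the vertex \<open>u\<close>; \<open>Upper\<close> and \<open>Lower\<close> tag the non-boundary vertices of
  \<open>G\<^sub>n\<close> and \<open>G\<^sub>n\<^sub>-\<^sub>1\<close>.\<close>

datatype gvertex = Base | Upper vertex | Lower vertex

definition upper :: "vertex \<Rightarrow> gvertex" where
  "upper x = (if x \<in> bdry then Base else Upper x)"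

definition lower :: "vertex \<Rightarrow> gvertex" where
  "lower x = (if x \<in> bdry then Base else Lower x)"

fun Gam :: "nat \<Rightarrow> gvertex multigraph" where
  "Gam 0 = \<lparr>verts = {Base}, edges = {#Upair Base Base, Upair Base Base#}\<rparr>"
| "Gam (Suc n) = \<lparr>
     verts = upper ` verts (G (Suc n)) \<union> lower ` verts (G n),
     edges = image_mset (map_uprod upper) (edges (G (Suc n)))
       + image_mset (map_uprod lower) (edges (G n))\<rparr>"

abbreviation u_vertex :: gvertex where "u_vertex \<equiv> Base"

text \<open>The vertex \<open>v\<close> of \<open>\<Gamma>\<^sub>n\<close>, for \<open>n \<ge> 2\<close>.\<close>

abbreviation v_vertex :: gvertex where "v_vertex \<equiv> Upper Centre"

definition born :: "(nat \<Rightarrow> real set) \<Rightarrow> nat \<Rightarrow> real \<Rightarrow> bool" where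
  "born S n lam \<longleftrightarrow> lam \<in> S n \<and> (\<forall>m<n. lam \<notin> S m)"

definition zero_series :: "nat \<Rightarrow> real \<Rightarrow> bool" where
  "zero_series n lam \<longleftrightarrow> born (\<lambda>k. Spec (Gam k)) n lam \<and>
     (n \<in> {0, 1} \<or>
      n \<ge> 2 \<and> (\<forall>f. eigenfunction (Gam n) lam f \<longrightarrow> f u_vertex * f v_vertex \<noteq> 0))"

text \<open>The monic polynomial with simple roots, namely the elements of the finite set \<open>S\<close>.\<close>

definition root_poly :: "real set \<Rightarrow> real poly" where
  "root_poly S = (\<Prod>r\<in>S. [:- r, 1:])"

definition gamma :: "nat \<Rightarrow> real poly" where
  "gamma n = (if n = 0 then 1 else root_poly {lam. born (\<lambda>k. DirSpec (G k) bdry) n lam})"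

definition psi :: "nat \<Rightarrow> real poly" where
  "psi n = root_poly {lam. zero_series n lam}"

definition Z :: "nat \<Rightarrow> real poly fract" where
  "Z n = to_fract (psi n * gamma (n - 2)) / to_fract (gamma n)"

text \<open>The index set is empty for \<open>n < 4\<close>, and otherwise \<open>n - 2 * j - 3\<close> is at least 1, so that
  the subtraction is never truncated.\<close>

definition eta :: "nat \<Rightarrow> real poly" where
  "eta n = gamma (n - 1) * (\<Prod>j | 2 * j + 4 \<le> n. gamma (n - 2 * j - 3) ^ (2 ^ j))"

definition zeta :: "nat \<Rightarrow> real poly fract" where
  "zeta n = to_fract (gamma n) / to_fract (eta n)"

end

theory Submission
  imports Defs
begin

text \<open>
  Between its two boundary vertices \<open>G\<^sub>n\<close> acts as a symmetric two-terminal network. If \<open>p\<^sub>n\<close>, \<open>- q\<^sub>n\<close> are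
  the entries of its Dirichlet-to-Neumann matrix at \<open>\<lambda>\<close>, then eliminating the gluing vertex of \<open>G\<^sub>n\<close>
  gives \<open>q\<^sub>n = q\<^sub>n\<^sub>-\<^sub>2\<^sup>2 / \<Phi>\<^sub>n\<close> and \<open>p\<^sub>n = p\<^sub>n\<^sub>-\<^sub>2 - q\<^sub>n\<close>, where
  \<open>\<Phi>\<^sub>n = 2 (p\<^sub>n\<^sub>-\<^sub>1 - q\<^sub>n\<^sub>-\<^sub>1) + 2 p\<^sub>n\<^sub>-\<^sub>2 - \<lambda>\<close>. New Dirichlet eigenvalues are zeros of \<open>\<Phi>\<^sub>n\<close>, and new
  0-series eigenvalues are zeros of \<open>\<Psi>\<^sub>n = \<Phi>\<^sub>n\<^sub>+\<^sub>1 - 2 q\<^sub>n\<^sub>-\<^sub>1\<close>. It turns out that \<open>\<zeta>\<^sub>n = \<Phi>\<^sub>n / q\<^sub>n\<^sub>-\<^sub>2\<close> and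
  \<open>Z\<^sub>n = 1 + 2 / \<zeta>\<^sub>n = \<Psi>\<^sub>n / \<Psi>\<^sub>n\<^sub>-\<^sub>1\<close>, whence \<open>\<zeta>\<^sub>n - 2 = Z\<^sub>n\<^sub>-\<^sub>1 (\<zeta>\<^sub>n\<^sub>-\<^sub>2\<^sup>2 - 4)\<close>; this is the claimed
  recursion.

  The numerators of \<open>\<zeta>\<^sub>n\<close> and \<open>Z\<^sub>n\<close> satisfy polynomial recursions from which no two of them share a
  root. Their roots are real and simple because \<open>Im \<Phi>\<^sub>n \<le> - Im \<lambda>\<close> and \<open>Im \<Psi>\<^sub>n \<le> - Im \<lambda>\<close> in the upper
  half plane: this rules out zeros there, and at \<open>a + \<i> t\<close> a double zero at a real \<open>a\<close> would make
  the modulus \<open>O(t\<^sup>2)\<close>.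
\<close>

section \<open>The polynomial recursions\<close>

text \<open>
  At the polynomial indeterminate these are \<open>\<gamma>\<^sub>n\<close>, \<open>\<psi>\<^sub>n\<close> and (for \<open>n \<ge> 3\<close>) \<open>\<eta>\<^sub>n / \<gamma>\<^sub>n\<^sub>-\<^sub>1\<close>. The values
  \<open>epol 1 = epol 2 = - 1\<close> have the opposite sign of the true quotients, because
  \<open>\<Phi>\<^sub>n / q\<^sub>n\<^sub>-\<^sub>2 = - \<zeta>\<^sub>n\<close> for \<open>n = 1, 2\<close>.
\<close>

fun gpol :: "nat \<Rightarrow> 'a::comm_ring_1 \<Rightarrow> 'a"
  and spol :: "nat \<Rightarrow> 'a \<Rightarrow> 'a"
  and epol :: "nat \<Rightarrow> 'a \<Rightarrow> 'a" where
  "gpol 0 x = 1"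
| "gpol (Suc 0) x = x - 2"
| "gpol (Suc (Suc 0)) x = x^2 - 6 * x + 4"
| "gpol (Suc (Suc (Suc n))) x =
     spol (Suc (Suc (Suc n))) x * gpol (Suc n) x
       - 2 * gpol (Suc (Suc n)) x * epol (Suc (Suc (Suc n))) x"
| "spol 0 x = x"
| "spol (Suc 0) x = x - 4"
| "spol (Suc (Suc 0)) x = x^2 - 8 * x + 8"
| "spol (Suc (Suc (Suc n))) x =
     spol (Suc (Suc n)) x * gpol (Suc n) x
       - 8 * epol (Suc (Suc (Suc n))) x * epol (Suc (Suc n)) x"
| "epol 0 x = 1"
| "epol (Suc 0) x = - 1"
| "epol (Suc (Suc 0)) x = - 1"
| "epol (Suc (Suc (Suc n))) x = gpol n x * epol (Suc n) x ^ 2"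

lemma pol_induct3:
  fixes P :: "nat \<Rightarrow> bool"
  assumes "P 0" "P (Suc 0)" "P (Suc (Suc 0))"
    and "\<And>n. P n \<Longrightarrow> P (Suc n) \<Longrightarrow> P (Suc (Suc n)) \<Longrightarrow> P (Suc (Suc (Suc n)))"
  shows "P n"
proof -
  have "P n \<and> P (Suc n) \<and> P (Suc (Suc n))"
    by (induction n) (use assms in auto)
  then show ?thesis by blast
qed

text \<open>The recursions use only ring operations and numerals. Applied to evaluation of
  polynomials, to complex conjugation and to the embedding of the reals into the complex
  numbers.\<close>

lemma pol_hom:
  fixes h :: "'a::comm_ring_1 \<Rightarrow> 'b::comm_ring_1"
  assumes add: "\<And>x y. h (x + y) = h x + h y" and mult: "\<And>x y. h (x * y) = h x * h y"
    and one: "h 1 = 1"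
  shows "h (gpol n x) = gpol n (h x) \<and> h (spol n x) = spol n (h x) \<and> h (epol n x) = epol n (h x)"
proof -
  have zero: "h 0 = 0" using add[of 0 0] by simp
  have minus: "h (- x) = - h x" for x using add[of x "- x"] zero by (simp add: eq_neg_iff_add_eq_0 add.commute)
  have diff: "h (x - y) = h x - h y" for x y using add[of x "- y"] minus by simp
  have nat: "h (of_nat n) = of_nat n" for n by (induction n) (simp_all add: zero one add)
  have num: "h (numeral k) = numeral k" for k using nat[of "numeral k"] by simp
  show ?thesis
    by (induction n rule: pol_induct3) (simp_all add: add mult one zero minus diff num power2_eq_square)
qed

text \<open>For \<open>n \<ge> 3\<close> this is \<open>Z n = 1 + 2 / zeta n\<close> cleared of
  denominators, a rearrangement of the recursion for \<open>gpol\<close>. The signs of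
  \<open>epol 1\<close> and \<open>epol 2\<close> make it hold at the start too, where truncation
  turns \<open>n - 2\<close> into \<open>0\<close>.\<close>

lemma gpol_gluing:
  assumes "n \<ge> 1"
  shows "spol n x * gpol (n - 2) x = gpol n x + 2 * gpol (n - 1) x * epol n x"
proof -
  consider "n = 1" | "n = 2" | m where "n = Suc (Suc (Suc m))"
    using assms by (metis One_nat_def Suc_1 not0_implies_Suc not_one_le_zero)
  then show ?thesis
    by cases (simp_all add: numeral_2_eq_2 algebra_simps power2_eq_square)
qed

text \<open>This is \<open>zeta (n + 2) - 2 = Z (n + 1) * (zeta n ^ 2 - 4)\<close> cleared of
  denominators, using \<open>epol (n + 2) x = gpol (n - 1) x * epol n x ^ 2\<close>.\<close>

lemma gpol_factor:
  assumes "n \<ge> 1"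
  shows "gpol (n + 2) x - 2 * gpol (n + 1) x * epol (n + 2) x =
    spol (n + 1) x * (gpol n x ^ 2 - 4 * (gpol (n - 1) x * epol n x) ^ 2)"
proof -
  obtain m where m: "n = Suc m" using assms by (metis One_nat_def Suc_le_D)
  have "spol (Suc (Suc m)) x * gpol m x = gpol (Suc (Suc m)) x + 2 * gpol (Suc m) x * epol (Suc (Suc m)) x"
    using gpol_gluing[of "Suc (Suc m)" x] by simp
  then have *: "gpol (Suc (Suc m)) x = spol (Suc (Suc m)) x * gpol m x - 2 * gpol (Suc m) x * epol (Suc (Suc m)) x"
    by simp
  show ?thesis
    unfolding m by (simp del: gpol.simps(3) spol.simps(3) epol.simps(3) add: *) (simp add: algebra_simps power2_eq_square)
qed

text \<open>The cofactor in \<open>gpol_prod\<close>, whose induction in steps of two picks up one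
  factor \<open>gpol (n - 2) x\<close> each time. For \<open>n < 2\<close> truncation makes it
  \<open>gpol 0 x = 1\<close>, matching the convention that \<gamma> is 1 at negative
  indices.\<close>

fun theta :: "nat \<Rightarrow> 'a::comm_ring_1 \<Rightarrow> 'a" where
  "theta 0 x = 1"
| "theta (Suc 0) x = 1"
| "theta (Suc (Suc n)) x = gpol (n - 2) x * theta n x"

text \<open>The right side of \<open>gpol_factor\<close> contains a difference of squares: one
  factor is the claim two levels down, and \<open>gpol_gluing\<close> turns the other into a
  multiple of \<open>spol\<close>. The product over all lower levels later describes the spectrum of
  the closed graphs away from roots of \<open>gpol\<close>.\<close>

lemma gpol_prod:
  assumes "n \<ge> 1"
  shows "gpol n x - 2 * gpol (n - 1) x * epol n x = (\<Prod>k<n. spol k x) * theta n x"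
  using assms
proof (induction n rule: less_induct)
  case (less n)
  consider "n = 1" | "n = 2" | m where "n = m + 2" "m \<ge> 1"
    using less.prems by (metis One_nat_def Suc_1 add_2_eq_Suc' not0_implies_Suc not_one_le_zero le_add1 plus_1_eq_Suc)
  then show ?case
  proof cases
    case 3
    have "gpol n x - 2 * gpol (n - 1) x * epol n x
        = spol (m + 1) x * ((gpol m x - 2 * gpol (m - 1) x * epol m x) * (gpol m x + 2 * gpol (m - 1) x * epol m x))"
      using gpol_factor[OF 3(2), of x] 3(1) by (simp add: algebra_simps power2_eq_square)
    also have "\<dots> = spol (m + 1) x * (((\<Prod>k<m. spol k x) * theta m x) * (spol m x * gpol (m - 2) x))"
      using less.IH[of m] 3 gpol_gluing[OF 3(2), of x] by simp
    finally show ?thesis using 3 by (simp add: algebra_simps)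
  qed (simp_all add: numeral_2_eq_2, simp_all add: algebra_simps power2_eq_square)
qed

section \<open>No two of the polynomials share a root\<close>

lemma epol_nonzero:
  fixes x :: "'a::{idom,ring_char_0}"
  assumes "\<And>k. k + 3 \<le> n \<Longrightarrow> gpol k x \<noteq> 0"
  shows "epol n x \<noteq> 0"
  using assms by (induction n rule: less_induct) (rename_tac n, case_tac "(n, x)" rule: epol.cases, auto)

lemma theta_nonzero:
  fixes x :: "'a::{idom,ring_char_0}"
  assumes "\<And>k. k + 3 \<le> n \<Longrightarrow> gpol k x \<noteq> 0"
  shows "theta n x \<noteq> 0"
  using assms
proof (induction n rule: less_induct)
  case (less n)
  consider "n = 0" | "n = 1" | m where "n = Suc (Suc m)" by (metis One_nat_def not0_implies_Suc)
  then show ?case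
  proof cases
    case 3
    have "gpol (m - 2) x \<noteq> 0" using less.prems[of "m - 2"] 3 by (cases "m \<ge> 2") auto
    then show ?thesis using less.IH[of m] less.prems 3 by auto
  qed auto
qed

text \<open>Levels up to \<open>m + 1\<close> follow from \<open>gpol_prod\<close> and
  \<open>gpol_gluing\<close>. From \<open>m + 3\<close> on every second \<open>epol\<close> is zero,
  which collapses the recursions to products of nonzero terms.\<close>

lemma gpol_unique:
  fixes x :: "'a::field_char_0"
  assumes m: "m \<ge> 1" "gpol m x = 0" and min: "\<And>k. k < m \<Longrightarrow> gpol k x \<noteq> 0"
  shows "(n \<noteq> m \<longrightarrow> gpol n x \<noteq> 0) \<and> spol n x \<noteq> 0"
proof -
  have e: "epol k x \<noteq> 0" if "k \<le> m + 2" for k by (rule epol_nonzero) (use min that in auto)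
  have th: "theta k x \<noteq> 0" if "k \<le> m + 2" for k by (rule theta_nonzero) (use min that in auto)
  have g1: "gpol (m - 1) x \<noteq> 0" "gpol (m - 2) x \<noteq> 0" using min m by auto
  have "(\<Prod>k<m. spol k x) \<noteq> 0"
    using gpol_prod[OF m(1), of x] m(2) g1 e[of m] by (metis diff_0 mult_eq_0_iff neg_equal_0_iff_equal le_add1 zero_neq_numeral)
  then have sless: "spol k x \<noteq> 0" if "k < m" for k using that by auto
  have sm: "spol m x \<noteq> 0"
    using gpol_gluing[OF m(1), of x] m(2) g1 e[of m] by auto
  have gm1: "gpol (m + 1) x \<noteq> 0"
    using gpol_prod[of "m + 1" x] m(2) sless sm th[of "m + 1"] by auto
  have sm1: "spol (m + 1) x \<noteq> 0"
    using gpol_gluing[of "m + 1" x] m(2) gm1 by auto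
  obtain l where l: "m = Suc l" using m(1) by (metis One_nat_def Suc_le_D)
  have sm2: "spol (m + 2) x = - 8 * epol (m + 2) x * epol (m + 1) x"
    using m(2) unfolding l by simp
  have gm2: "gpol (m + 2) x = - 2 * gpol (m + 1) x * epol (m + 2) x"
    using m(2) unfolding l by simp
  have em3: "epol (m + 3) x = 0"
    using m(2) by (simp add: numeral_3_eq_3)
  \<comment> \<open>The last clause says that \<open>gpol / (gpol * epol)\<close>, the value of
    \<zeta>, is 2 or -2 at level \<open>m + 2 * k + 2\<close>. It is -2 for \<open>k = 0\<close> and
    2 afterwards; the square covers both. It keeps the difference in the recursion for
    \<open>gpol\<close> from cancelling.\<close>
  have T: "epol (m + 2 * k + 2) x \<noteq> 0 \<and> epol (m + 2 * k + 3) x = 0 \<and> gpol (m + 2 * k + 1) x \<noteq> 0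
     \<and> gpol (m + 2 * k + 2) x \<noteq> 0 \<and> spol (m + 2 * k + 1) x \<noteq> 0 \<and> spol (m + 2 * k + 2) x \<noteq> 0
     \<and> gpol (m + 2 * k + 2) x ^ 2 = 4 * (gpol (m + 2 * k + 1) x * epol (m + 2 * k + 2) x) ^ 2" for k
  proof (induction k)
    case 0
    show ?case using e[of "m + 2"] e[of "m + 1"] em3 gm1 gm2 sm1 sm2
      by (simp add: power_mult_distrib)
  next
    case (Suc k)
    define N where "N = m + 2 * k"
    note IH = Suc.IH[folded N_def]
    have e4: "epol (N + 4) x = gpol (N + 1) x * epol (N + 2) x ^ 2"
      by (simp add: eval_nat_numeral)
    have e5: "epol (N + 5) x = 0" using IH by (simp add: eval_nat_numeral)
    have s3: "spol (N + 3) x = spol (N + 2) x * gpol (N + 1) x"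
      using IH by (simp add: eval_nat_numeral)
    have g3: "gpol (N + 3) x = spol (N + 3) x * gpol (N + 1) x"
      using IH by (simp add: eval_nat_numeral del: spol.simps)
    have s4: "spol (N + 4) x = spol (N + 3) x * gpol (N + 2) x"
      using IH by (simp add: eval_nat_numeral del: gpol.simps)
    have "gpol (N + 4) x = spol (N + 4) x * gpol (N + 2) x - 2 * gpol (N + 3) x * epol (N + 4) x"
      by (simp add: eval_nat_numeral del: spol.simps epol.simps)
    also have "\<dots> = spol (N + 3) x * gpol (N + 2) x ^ 2 - 2 * gpol (N + 3) x * epol (N + 4) x"
      by (simp add: s4 power2_eq_square)
    also have "gpol (N + 2) x ^ 2 = 4 * (gpol (N + 1) x * epol (N + 2) x) ^ 2" using IH by simp
    finally have g4: "gpol (N + 4) x = 2 * (gpol (N + 3) x * epol (N + 4) x)"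
      by (simp add: g3 e4 power2_eq_square algebra_simps)
    have idx: "m + 2 * Suc k + 1 = N + 3" "m + 2 * Suc k + 2 = N + 4" "m + 2 * Suc k + 3 = N + 5"
      by (simp_all add: N_def)
    have "spol (N + 3) x \<noteq> 0" "spol (N + 4) x \<noteq> 0" "gpol (N + 3) x \<noteq> 0" "epol (N + 4) x \<noteq> 0"
      using IH s3 s4 g3 e4 by auto
    moreover from this have "gpol (N + 4) x \<noteq> 0" using g4 by simp
    moreover have "gpol (N + 4) x ^ 2 = 4 * (gpol (N + 3) x * epol (N + 4) x) ^ 2"
      unfolding g4 by (simp add: power2_eq_square)
    ultimately show ?case unfolding idx using e5 by blast
  qed
  consider "n < m" | "n = m" | k where "n = m + 2 * k + 1" | k where "n = m + 2 * k + 2"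
  proof -
    have "n < m \<or> n = m \<or> (\<exists>k. n = m + 2 * k + 1) \<or> (\<exists>k. n = m + 2 * k + 2)" by presburger
    then show ?thesis using that by blast
  qed
  then show ?thesis using min sless sm T by cases auto
qed

lemma gpol_zero_unique:
  fixes x :: "'a::field_char_0"
  assumes "gpol m x = 0"
  shows "n \<noteq> m \<Longrightarrow> gpol n x \<noteq> 0" and "spol n x \<noteq> 0"
proof -
  define l where "l = (LEAST k. gpol k x = 0)"
  have l: "gpol l x = 0" unfolding l_def using assms by (rule LeastI)
  have lm: "gpol k x \<noteq> 0" if "k < l" for k using that not_less_Least unfolding l_def by blast
  have l1: "l \<ge> 1" using l by (cases l) auto
  note u = gpol_unique[OF l1 l lm]
  have "m = l" using u[of m] assms by blast
  then show "n \<noteq> m \<Longrightarrow> gpol n x \<noteq> 0" and "spol n x \<noteq> 0" using u[of n] by auto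
qed

text \<open>A root of \<open>spol i\<close> kills the product in \<open>gpol_prod\<close> at every
  later level \<open>j\<close>; \<open>gpol_gluing\<close> then gives
  \<open>spol j x * gpol (j - 2) x = 2 * gpol j x\<close>, which is nonzero.\<close>

lemma spol_zero_unique:
  fixes x :: "'a::field_char_0"
  assumes "spol m x = 0"
  shows "gpol n x \<noteq> 0" and "n \<noteq> m \<Longrightarrow> spol n x \<noteq> 0"
proof -
  show g: "gpol n x \<noteq> 0" for n using gpol_zero_unique(2)[of n x m] assms by blast
  have *: "spol j x \<noteq> 0" if "spol i x = 0" "i < j" for i j
  proof -
    have "gpol j x - 2 * gpol (j - 1) x * epol j x = 0"
      using gpol_prod[of j x] that by auto
    then have "spol j x * gpol (j - 2) x = 2 * gpol j x"
      using gpol_gluing[of j x] that by auto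
    then show ?thesis using g[of j] by auto
  qed
  show "spol n x \<noteq> 0" if "n \<noteq> m"
    using *[of m n] *[of n m] assms that by (cases "m < n") auto
qed

section \<open>Laplacians of glued graphs\<close>

definition wf_graph :: "'a multigraph \<Rightarrow> bool" where
  "wf_graph H \<longleftrightarrow> finite (verts H) \<and> (\<forall>p\<in>#edges H. set_uprod p \<subseteq> verts H)"

lemma laplacian_edges_empty: "laplacian \<lparr>verts = V, edges = {#}\<rparr> f x = 0"
  by (simp add: laplacian_def edge_count_def)

lemma laplacian_edges_add:
  "laplacian \<lparr>verts = V, edges = M + N\<rparr> f x =
     laplacian \<lparr>verts = V, edges = M\<rparr> f x + laplacian \<lparr>verts = V, edges = N\<rparr> f x"
  by (simp add: laplacian_def edge_count_def sum.distrib [symmetric] algebra_simps)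

lemma laplacian_edge:
  assumes "finite V" "a \<in> V" "b \<in> V"
  shows "laplacian \<lparr>verts = V, edges = {#Upair a b#}\<rparr> f x =
    (if x = a then f a - f b else 0) + (if x = b then f b - f a else 0)"
proof -
  have "laplacian \<lparr>verts = V, edges = {#Upair a b#}\<rparr> f x =
      (\<Sum>y\<in>V. (if y = b then (if x = a then f a - f b else 0) else 0) +
               (if y = a then (if x = b then f b - f a else 0) else 0))"
    unfolding laplacian_def edge_count_def by (rule sum.cong) auto
  then show ?thesis using assms by (simp add: sum.distrib)
qed

lemma laplacian_edges_add_mset:
  "laplacian \<lparr>verts = V, edges = add_mset p M\<rparr> f x =
     laplacian \<lparr>verts = V, edges = {#p#}\<rparr> f x + laplacian \<lparr>verts = V, edges = M\<rparr> f x"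
  using laplacian_edges_add[of V "{#p#}" M f x] by simp

text \<open>Both sides are additive in the edges, so a single edge suffices. The map
  \<open>h\<close> need not be injective: fluxes at identified vertices add up, and an edge whose
  ends are identified contributes zero on both sides.\<close>

lemma laplacian_image:
  assumes "wf_graph H" "finite W" "h ` verts H \<subseteq> W"
  shows "laplacian \<lparr>verts = W, edges = image_mset (map_uprod h) (edges H)\<rparr> f x =
    (\<Sum>y | y \<in> verts H \<and> h y = x. laplacian H (f \<circ> h) y)"
proof -
  define V where "V = verts H"
  have fin: "finite V" using assms by (simp add: wf_graph_def V_def)
  have hV: "h ` V \<subseteq> W" using assms by (simp add: V_def)
  have "laplacian \<lparr>verts = W, edges = image_mset (map_uprod h) M\<rparr> f x =
      (\<Sum>y | y \<in> V \<and> h y = x. laplacian \<lparr>verts = V, edges = M\<rparr> (\<lambda>z. f (h z)) y)"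
    if "\<forall>p\<in>#M. set_uprod p \<subseteq> V" for M
    using that
  proof (induction M)
    case (add p M)
    obtain a b where p: "p = Upair a b" by (cases p) auto
    have ab: "a \<in> V" "b \<in> V" using add.prems p by auto
    have fin': "finite {y. y \<in> V \<and> h y = x}" using fin by auto
    have "laplacian \<lparr>verts = W, edges = {#map_uprod h p#}\<rparr> f x =
       (\<Sum>y | y \<in> V \<and> h y = x. laplacian \<lparr>verts = V, edges = {#p#}\<rparr> (\<lambda>z. f (h z)) y)"
      unfolding p using ab hV assms(2) fin fin'
      by (simp add: laplacian_edge image_subset_iff sum.distrib)
    with add show ?case
      by (simp add: laplacian_edges_add_mset[of _ _ "image_mset _ _"] laplacian_edges_add_mset[of V p M] sum.distrib)
  qed (simp add: laplacian_edges_empty)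
  from this[of "edges H"] show ?thesis
    using assms(1) by (simp add: wf_graph_def V_def o_def laplacian_def edge_count_def)
qed

lemma laplacian_scale: "laplacian H (\<lambda>y. c * f y) x = c * laplacian H f x"
  by (simp add: laplacian_def sum_distrib_left algebra_simps)

lemma wf_graph_image:
  assumes "wf_graph H"
  shows "finite (h ` verts H)" "p \<in># image_mset (map_uprod h) (edges H) \<Longrightarrow> set_uprod p \<subseteq> h ` verts H"
  using assms by (auto simp: wf_graph_def uprod.set_map subset_iff)

lemma wf_graph_G: "wf_graph (G n)"
proof (induction n rule: G.induct)
  case (3 n)
  have fin: "finite (verts (G (Suc (Suc n))))"
    using 3 by (simp add: wf_graph_def)
  have E: "edges (G (Suc (Suc n))) = image_mset (map_uprod (glue Big)) (edges (G (Suc n)))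
       + image_mset (map_uprod (glue Lft)) (edges (G n))
       + image_mset (map_uprod (glue Rgt)) (edges (G n))" by simp
  have "set_uprod p \<subseteq> verts (G (Suc (Suc n)))" if p: "p \<in># edges (G (Suc (Suc n)))" for p
  proof -
    consider "p \<in># image_mset (map_uprod (glue Big)) (edges (G (Suc n)))"
      | "p \<in># image_mset (map_uprod (glue Lft)) (edges (G n))"
      | "p \<in># image_mset (map_uprod (glue Rgt)) (edges (G n))"
      using p unfolding E union_iff by blast
    then show ?thesis
      by cases (use wf_graph_image(2)[OF 3(1)] wf_graph_image(2)[OF 3(2)] in \<open>fastforce+\<close>)
  qed
  with fin show ?case unfolding wf_graph_def by blast
qed (auto simp: wf_graph_def)

lemma finite_verts_G: "finite (verts (G n))"
  using wf_graph_G[of n] by (simp add: wf_graph_def)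

lemma End_in_verts [simp]: "End b \<in> verts (G n)"
proof (induction n arbitrary: b rule: G.induct)
  case 1
  then show ?case by (cases b) auto
next
  case 2
  then show ?case by (cases b) auto
next
  case (3 n)
  have "End False = glue Lft (End False)" "End True = glue Rgt (End True)" by simp_all
  then show ?case using 3(2) by (cases b) (auto simp del: glue.simps)
qed

lemma Centre_in_verts [simp]: "Centre \<in> verts (G (Suc n))"
proof (cases n)
  case (Suc k)
  have "Centre = glue Big (End False)" by simp
  then show ?thesis using End_in_verts[of False n] Suc by (auto simp del: glue.simps)
qed simp

lemma glue_eq:
  "glue Big x = End b \<longleftrightarrow> False"
  "glue Big x = Centre \<longleftrightarrow> x \<in> bdry"
  "glue Lft x = End b \<longleftrightarrow> \<not> b \<and> x = End False"
  "glue Lft x = Centre \<longleftrightarrow> x = End True"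
  "glue Rgt x = End b \<longleftrightarrow> b \<and> x = End True"
  "glue Rgt x = Centre \<longleftrightarrow> x = End False"
  subgoal by (cases x) auto
  subgoal by (cases x) (auto simp: bdry_def)
  subgoal by (cases x) auto
  subgoal by (cases x) auto
  subgoal by (cases x) auto
  subgoal by (cases x) auto
  done

lemma glue_eq_Inner: "glue p x = Inner q y \<longleftrightarrow> x \<notin> bdry \<and> p = q \<and> x = y"
  by (cases x; cases p) (auto simp: bdry_def)

lemma glue_in_verts:
  "x \<in> verts (G (Suc n)) \<Longrightarrow> glue Big x \<in> verts (G (Suc (Suc n)))"
  "x \<in> verts (G n) \<Longrightarrow> glue Lft x \<in> verts (G (Suc (Suc n)))"
  "x \<in> verts (G n) \<Longrightarrow> glue Rgt x \<in> verts (G (Suc (Suc n)))"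
  by simp_all

lemma laplacian_G_glue:
  "laplacian (G (Suc (Suc n))) f x =
     (\<Sum>y | y \<in> verts (G (Suc n)) \<and> glue Big y = x. laplacian (G (Suc n)) (f \<circ> glue Big) y)
   + (\<Sum>y | y \<in> verts (G n) \<and> glue Lft y = x. laplacian (G n) (f \<circ> glue Lft) y)
   + (\<Sum>y | y \<in> verts (G n) \<and> glue Rgt y = x. laplacian (G n) (f \<circ> glue Rgt) y)"
proof -
  define W where "W = verts (G (Suc (Suc n)))"
  have W: "finite W" "glue Big ` verts (G (Suc n)) \<subseteq> W" "glue Lft ` verts (G n) \<subseteq> W"
    "glue Rgt ` verts (G n) \<subseteq> W"
    using finite_verts_G by (auto simp: W_def)
  have "G (Suc (Suc n)) = \<lparr>verts = W, edges = image_mset (map_uprod (glue Big)) (edges (G (Suc n)))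
       + image_mset (map_uprod (glue Lft)) (edges (G n))
       + image_mset (map_uprod (glue Rgt)) (edges (G n))\<rparr>"
    by (simp add: W_def)
  then show ?thesis
    using W by (simp only: laplacian_edges_add laplacian_image[OF wf_graph_G])
qed

lemma Collect_eq_conv: "{y. y \<in> A \<and> y = a} = (if a \<in> A then {a} else {})"
  by auto

lemma laplacian_G_End:
  "laplacian (G (Suc (Suc n))) f (End False) = laplacian (G n) (f \<circ> glue Lft) (End False)"
  "laplacian (G (Suc (Suc n))) f (End True) = laplacian (G n) (f \<circ> glue Rgt) (End True)"
  by (simp_all add: laplacian_G_glue glue_eq Collect_eq_conv del: G.simps)

lemma laplacian_G_Centre:
  "laplacian (G (Suc (Suc n))) f Centre =
     laplacian (G (Suc n)) (f \<circ> glue Big) (End False) + laplacian (G (Suc n)) (f \<circ> glue Big) (End True)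
     + laplacian (G n) (f \<circ> glue Lft) (End True) + laplacian (G n) (f \<circ> glue Rgt) (End False)"
proof -
  have "{y. y \<in> verts (G (Suc n)) \<and> y \<in> bdry} = {End False, End True}"
    by (auto simp: bdry_def)
  then show ?thesis
    by (simp add: laplacian_G_glue glue_eq Collect_eq_conv del: G.simps)
qed

lemma laplacian_G_Inner:
  assumes "x \<notin> bdry"
  shows "x \<in> verts (G (Suc n)) \<Longrightarrow>
      laplacian (G (Suc (Suc n))) f (glue Big x) = laplacian (G (Suc n)) (f \<circ> glue Big) x"
    and "x \<in> verts (G n) \<Longrightarrow>
      laplacian (G (Suc (Suc n))) f (glue Lft x) = laplacian (G n) (f \<circ> glue Lft) x"
    and "x \<in> verts (G n) \<Longrightarrow>
      laplacian (G (Suc (Suc n))) f (glue Rgt x) = laplacian (G n) (f \<circ> glue Rgt) x"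
proof -
  have *: "glue p x = Inner p x" for p using glue_eq_Inner assms by blast
  have **: "{y. y \<in> A \<and> y \<notin> bdry \<and> y = x} = (if x \<in> A then {x} else {})" for A
    using assms by auto
  show "x \<in> verts (G (Suc n)) \<Longrightarrow>
      laplacian (G (Suc (Suc n))) f (glue Big x) = laplacian (G (Suc n)) (f \<circ> glue Big) x"
    and "x \<in> verts (G n) \<Longrightarrow>
      laplacian (G (Suc (Suc n))) f (glue Lft x) = laplacian (G n) (f \<circ> glue Lft) x"
    and "x \<in> verts (G n) \<Longrightarrow>
      laplacian (G (Suc (Suc n))) f (glue Rgt x) = laplacian (G n) (f \<circ> glue Rgt) x"
    unfolding * by (simp_all add: laplacian_G_glue glue_eq_Inner ** del: G.simps)
qed

lemma laplacian_G_0: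
  "laplacian (G 0) f (End False) = f (End False) - f (End True)"
  "laplacian (G 0) f (End True) = f (End True) - f (End False)"
  by (simp_all add: laplacian_edge)

lemma laplacian_G_1:
  "laplacian (G (Suc 0)) f (End b) = f (End b) - f Centre"
  "laplacian (G (Suc 0)) f Centre = 2 * f Centre - f (End False) - f (End True)"
  by (auto simp: laplacian_edges_add_mset[of _ _ "add_mset _ _"] laplacian_edges_add_mset[of _ _ "{#_#}"] laplacian_edge)

definition solves :: "nat \<Rightarrow> real \<Rightarrow> (vertex \<Rightarrow> real) \<Rightarrow> bool" where
  "solves n lam f \<longleftrightarrow> (\<forall>x\<in>verts (G n) - bdry. laplacian (G n) f x = lam * f x)"

lemma verts_G_interior:
  "verts (G (Suc (Suc n))) - bdry =
     {Centre} \<union> glue Big ` (verts (G (Suc n)) - bdry) \<union> glue Lft ` (verts (G n) - bdry)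
       \<union> glue Rgt ` (verts (G n) - bdry)" (is "?A = ?B")
proof
  show "?A \<subseteq> ?B"
  proof
    fix x assume x: "x \<in> ?A"
    then consider y where "x = glue Big y" "y \<in> verts (G (Suc n))"
      | y where "x = glue Lft y" "y \<in> verts (G n)" | y where "x = glue Rgt y" "y \<in> verts (G n)"
      by auto
    then show "x \<in> ?B"
    proof cases
      case (1 y)
      then show ?thesis using x by (cases "y \<in> bdry") (auto simp: bdry_def)
    next
      case (2 y)
      then show ?thesis using x by (cases "y \<in> bdry") (auto simp: bdry_def)
    next
      case (3 y)
      then show ?thesis using x by (cases "y \<in> bdry") (auto simp: bdry_def)
    qed
  qed
  show "?B \<subseteq> ?A"
    using Centre_in_verts[of "Suc n"]
    by (auto simp: bdry_def glue_eq eq_commute[of "End _"] simp del: G.simps intro: glue_in_verts)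
qed

text \<open>An interior vertex of a copy meets only edges of that copy, so gluing adds one equation:
  the balance of the four ends that meet at \<open>Centre\<close>.\<close>

lemma solves_glue:
  "solves (Suc (Suc n)) lam f \<longleftrightarrow>
     solves (Suc n) lam (f \<circ> glue Big) \<and> solves n lam (f \<circ> glue Lft) \<and> solves n lam (f \<circ> glue Rgt) \<and>
     laplacian (G (Suc n)) (f \<circ> glue Big) (End False) + laplacian (G (Suc n)) (f \<circ> glue Big) (End True)
     + laplacian (G n) (f \<circ> glue Lft) (End True) + laplacian (G n) (f \<circ> glue Rgt) (End False) = lam * f Centre"
  unfolding solves_def verts_G_interior
  by (auto simp: laplacian_G_Inner laplacian_G_Centre ball_Un simp del: G.simps)

lemma solves_0 [simp]: "solves 0 lam f"
  by (simp add: solves_def bdry_def)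

lemma solves_1: "solves (Suc 0) lam f \<longleftrightarrow> 2 * f Centre - f (End False) - f (End True) = lam * f Centre"
proof -
  have "verts (G (Suc 0)) - bdry = {Centre}" by (auto simp: bdry_def)
  then show ?thesis by (simp add: solves_def laplacian_G_1 del: G.simps)
qed

text \<open>The values of the parts at the identified ends are discarded in favour of
  \<open>c\<close>; \<open>glue_fun_comp\<close> recovers the parts when they equal \<open>c\<close>
  there.\<close>

fun glue_fun :: "real \<Rightarrow> (part \<Rightarrow> vertex \<Rightarrow> real) \<Rightarrow> vertex \<Rightarrow> real" where
  "glue_fun c h (End b) = (if b then h Rgt (End True) else h Lft (End False))"
| "glue_fun c h Centre = c"
| "glue_fun c h (Inner p x) = h p x"

lemma glue_fun_comp:
  assumes "h Big (End False) = c" "h Big (End True) = c" "h Lft (End True) = c" "h Rgt (End False) = c"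
  shows "glue_fun c h \<circ> glue p = h p"
proof
  fix x show "(glue_fun c h \<circ> glue p) x = h p x"
  proof (cases x)
    case (End b)
    then show ?thesis using assms by (cases p; cases b) auto
  qed auto
qed

section \<open>The network recursion\<close>

text \<open>The index is shifted by one: \<open>pseq (Suc n)\<close> and \<open>qseq (Suc n)\<close> belong to \<open>G\<^sub>n\<close>. Index \<open>0\<close> belongs to a
  formal \<open>G\<^sub>-\<^sub>1\<close>, a single edge, which makes \<open>G\<^sub>1\<close> an instance of the gluing rule.\<close>

fun pseq :: "nat \<Rightarrow> 'a::field \<Rightarrow> 'a" and qseq :: "nat \<Rightarrow> 'a \<Rightarrow> 'a" where
  "pseq 0 x = 1"
| "pseq (Suc 0) x = 1"
| "pseq (Suc (Suc n)) x = pseq n x - qseq (Suc (Suc n)) x"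
| "qseq 0 x = 1"
| "qseq (Suc 0) x = 1"
| "qseq (Suc (Suc n)) x = qseq n x ^ 2 / (2 * (pseq (Suc n) x - qseq (Suc n) x) + 2 * pseq n x - x)"

text \<open>Here the index is not shifted: for \<open>n \<ge> 1\<close>, \<open>Phi n x\<close> is
  the coefficient of the value at the gluing vertex of \<open>G n\<close> (at \<open>Centre\<close>
  for \<open>n = 1\<close>).\<close>

definition Phi :: "nat \<Rightarrow> 'a::field \<Rightarrow> 'a" where
  "Phi n x = 2 * (pseq n x - qseq n x) + 2 * pseq (n - 1) x - x"

lemma qseq_Phi: "qseq (Suc (Suc n)) x = qseq n x ^ 2 / Phi (Suc n) x"
  by (simp add: Phi_def)

lemma pseq_Phi: "pseq (Suc (Suc n)) x = pseq n x - qseq n x ^ 2 / Phi (Suc n) x"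
  by (simp add: Phi_def)

declare pseq.simps(3) [simp del] qseq.simps(3) [simp del]

lemma Phi_1: "Phi (Suc 0) x = 2 - x"
  by (simp add: Phi_def)

lemma qseq_nonzero:
  assumes "\<And>k. 1 \<le> k \<Longrightarrow> k < n \<Longrightarrow> Phi k x \<noteq> 0"
  shows "qseq n x \<noteq> 0"
  using assms
proof (induction n rule: less_induct)
  case (less n)
  consider "n = 0" | "n = 1" | m where "n = Suc (Suc m)" by (metis One_nat_def not0_implies_Suc)
  then show ?case
  proof cases
    case 3
    have "qseq m x \<noteq> 0" using less 3 by simp
    moreover have "Phi (Suc m) x \<noteq> 0" using less.prems 3 by simp
    ultimately show ?thesis using 3 by (simp add: qseq_Phi)
  qed auto
qed

text \<open>The relation \<open>pseq (n + 2) x + qseq (n + 2) x = pseq n x\<close> eliminates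
  \<open>pseq\<close>, leaving a recursion in \<open>Phi\<close> and \<open>qseq\<close>
  alone.\<close>

lemma Phi_Suc: "Phi (Suc (Suc n)) x = Phi (Suc n) x - 4 * qseq (Suc (Suc n)) x + 2 * qseq (Suc n) x"
  by (simp add: Phi_def pseq_Phi qseq_Phi algebra_simps)

text \<open>The quotients \<open>Phi (Suc k) x / qseq k x\<close> and \<open>z (Suc k)\<close> obey
  the same recursion \<open>zrec\<close> and start equal. The hypothesis stops at \<open>n\<close>,
  so \<open>Phi (Suc n) x\<close> itself may be zero.\<close>

lemma Phi_gpol:
  fixes x :: "'a::field_char_0"
  assumes "\<And>k. k \<le> n \<Longrightarrow> gpol k x \<noteq> 0"
  shows "Phi (Suc n) x = qseq n x * (gpol (Suc n) x / (gpol n x * epol (Suc n) x))"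
    and "\<And>k. 1 \<le> k \<Longrightarrow> k \<le> n \<Longrightarrow> Phi k x \<noteq> 0"
proof -
  define z where "z k = gpol k x / (gpol (k - 1) x * epol k x)" for k
  have e: "epol k x \<noteq> 0" if "k \<le> n + 3" for k by (rule epol_nonzero) (use assms that in auto)
  have z0: "z k \<noteq> 0" if "k \<ge> 1" "k \<le> n" for k
    using assms e that by (auto simp: z_def)
  have zrec: "z (k + 2) - 2 = (1 + 2 / z (k + 1)) * (z k ^ 2 - 4)" if k: "k \<ge> 1" "k + 1 \<le> n" for k
  proof -
    have nz: "gpol k x \<noteq> 0" "gpol (k + 1) x \<noteq> 0" "gpol (k - 1) x \<noteq> 0" "epol k x \<noteq> 0" "epol (k + 1) x \<noteq> 0"
      "epol (k + 2) x \<noteq> 0"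
      using assms e k by auto
    obtain l where l: "k = Suc l" using k(1) by (metis One_nat_def Suc_le_D)
    have e2: "epol (k + 2) x = gpol (k - 1) x * epol k x ^ 2"
      unfolding l by simp
    have A: "1 + 2 / z (k + 1) = spol (k + 1) x * gpol (k - 1) x / gpol (k + 1) x"
      using gpol_gluing[of "k + 1" x] nz by (simp add: z_def field_simps)
    have B: "z k ^ 2 - 4 = (gpol k x ^ 2 - 4 * (gpol (k - 1) x * epol k x) ^ 2) / (gpol (k - 1) x * epol k x) ^ 2"
      using nz by (simp add: z_def field_simps)
    have "z (k + 2) - 2 = (gpol (k + 2) x - 2 * gpol (k + 1) x * epol (k + 2) x) / (gpol (k + 1) x * epol (k + 2) x)"
      using nz by (simp add: z_def field_simps)
    also have "\<dots> = spol (k + 1) x * (gpol k x ^ 2 - 4 * (gpol (k - 1) x * epol k x) ^ 2) / (gpol (k + 1) x * (gpol (k - 1) x * epol k x ^ 2))"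
      using gpol_factor[OF k(1), of x] by (simp only: e2)
    also have "\<dots> = (1 + 2 / z (k + 1)) * (z k ^ 2 - 4)"
      unfolding A B using nz by (simp add: field_simps power2_eq_square)
    finally show ?thesis .
  qed
  have main: "(k \<le> n \<longrightarrow> Phi (Suc k) x = qseq k x * z (Suc k)) \<and>
      (Suc k \<le> n \<longrightarrow> Phi (Suc (Suc k)) x = qseq (Suc k) x * z (Suc (Suc k)))" for k
  proof (induction k)
    case 0
    have "Phi (Suc (Suc 0)) x = z (Suc (Suc 0))" if "1 \<le> n"
    proof -
      have "x - 2 \<noteq> 0" using assms[of "Suc 0"] that by simp
      moreover from this have "2 - x \<noteq> 0" by (simp add: algebra_simps)
      ultimately show ?thesis
        by (simp add: Phi_Suc qseq_Phi Phi_1 z_def divide_simps del: right_minus_eq)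
          (simp add: algebra_simps power2_eq_square)
    qed
    then show ?case by (simp add: Phi_1 z_def)
  next
    case (Suc k)
    have "Phi (Suc (Suc (Suc k))) x = qseq (Suc (Suc k)) x * z (Suc (Suc (Suc k)))" if kn: "Suc (Suc k) \<le> n"
    proof -
      define Q q a b where "Q = qseq k x" and "q = qseq (Suc k) x" and "a = z (Suc k)" and "b = z (Suc (Suc k))"
      have P1: "Phi (Suc k) x = Q * a" and P2: "Phi (Suc (Suc k)) x = q * b"
        using Suc.IH kn by (simp_all add: Q_def q_def a_def b_def)
      have nz: "a \<noteq> 0" "b \<noteq> 0" using z0 kn by (simp_all add: a_def b_def)
      have q2: "qseq (Suc (Suc k)) x = Q / a" using nz by (simp add: qseq_Phi P1 Q_def[symmetric] power2_eq_square)
      have q3: "qseq (Suc (Suc (Suc k))) x = q / b" using nz by (simp add: qseq_Phi P2 q_def[symmetric] power2_eq_square)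
      have "q * b = Q * a - 4 * (Q / a) + 2 * q"
        using Phi_Suc[of k x] by (simp add: P1 P2 q2 q_def)
      \<comment> \<open>\<open>Phi_Suc\<close> at one level gives \<open>r\<close>; at the next it
        gives \<open>q * b - 4 * (q / b)\<close>, which is
        \<open>(1 + 2 / b) * (q * (b - 2))\<close>. Substituting \<open>r\<close> there reproduces
        \<open>zrec\<close>.\<close>
      then have r: "q * (b - 2) = (Q / a) * (a^2 - 4)"
        using nz by (simp add: field_simps power2_eq_square)
      have zz: "z (Suc (Suc (Suc k))) = 2 + (1 + 2 / b) * (a^2 - 4)"
        using zrec[of "Suc k"] kn by (simp add: a_def b_def algebra_simps)
      have "Phi (Suc (Suc (Suc k))) x = q * b - 4 * (q / b) + 2 * (Q / a)"
        using Phi_Suc[of "Suc k" x] by (simp add: P2 q2 q3)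
      also have "\<dots> = (1 + 2 / b) * (q * (b - 2)) + 2 * (Q / a)"
        using nz by (simp add: field_simps)
      also have "\<dots> = (Q / a) * (2 + (1 + 2 / b) * (a^2 - 4))"
        unfolding r by (simp only: algebra_simps)
      finally show ?thesis by (simp add: zz q2)
    qed
    then show ?case using Suc by simp
  qed
  show "Phi (Suc n) x = qseq n x * (gpol (Suc n) x / (gpol n x * epol (Suc n) x))"
    using main[of n] by (simp add: z_def)
  show "Phi k x \<noteq> 0" if "1 \<le> k" "k \<le> n" for k
    using that
  proof (induction k rule: less_induct)
    case (less k)
    obtain l where l: "k = Suc l" using less.prems by (metis One_nat_def Suc_le_D)
    have "qseq l x \<noteq> 0"
      by (rule qseq_nonzero) (use less l in auto)
    then show ?case using main[of l] z0[of k] less.prems l by auto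
  qed
qed

text \<open>Cleared of denominators, zeros of \<open>Phi\<close> and of \<Psi> can be compared with
  roots of \<open>gpol\<close> and \<open>spol\<close>. As \<open>qseq n\<close> belongs to the
  graph of index \<open>n - 1\<close>, the third left side contains \<Psi> at index
  \<open>n\<close>.\<close>

lemma gpol_Phi:
  fixes x :: "'a::field_char_0"
  assumes "\<And>k. k \<le> n \<Longrightarrow> gpol k x \<noteq> 0"
  shows "qseq n x \<noteq> 0"
    and "Phi (Suc n) x * (gpol n x * epol (Suc n) x) = qseq n x * gpol (Suc n) x"
    and "(Phi (Suc n) x - 2 * qseq n x) * (gpol n x * epol (Suc n) x) =
      qseq n x * ((\<Prod>k\<le>n. spol k x) * theta (Suc n) x)"
proof -
  have "epol (Suc n) x \<noteq> 0" by (rule epol_nonzero) (use assms in auto)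
  then have nz: "gpol n x \<noteq> 0" "epol (Suc n) x \<noteq> 0" using assms by auto
  show "qseq n x \<noteq> 0"
    by (rule qseq_nonzero; use Phi_gpol(2)[OF assms] in force)
  show *: "Phi (Suc n) x * (gpol n x * epol (Suc n) x) = qseq n x * gpol (Suc n) x"
    using Phi_gpol(1)[OF assms] nz by simp
  show "(Phi (Suc n) x - 2 * qseq n x) * (gpol n x * epol (Suc n) x) =
      qseq n x * ((\<Prod>k\<le>n. spol k x) * theta (Suc n) x)"
  proof -
    have "(Phi (Suc n) x - 2 * qseq n x) * (gpol n x * epol (Suc n) x) =
        qseq n x * (gpol (Suc n) x - 2 * gpol n x * epol (Suc n) x)"
      using * by (simp add: algebra_simps)
    then show ?thesis using gpol_prod[of "Suc n" x] by (simp add: lessThan_Suc_atMost)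
  qed
qed

section \<open>Real and simple roots\<close>

text \<open>With boundary values 1 at both ends of the glued network, \<open>c\<close> is the value
  at the gluing vertex and \<open>p - q * c\<close> the flux at an end. The first two hypotheses
  bound the eigenvalues of the old Dirichlet-to-Neumann matrix.\<close>

lemma Im_series_bound:
  fixes p q s x c :: complex
  assumes "Im (p - q) \<le> 0" "Im (p + q) \<le> 0" "Im s \<le> 0" "Im x \<ge> 0"
    and c: "c * (2 * s + 2 * p - x) = 2 * q"
  shows "Im (p - q * c) \<le> 0"
proof -
  define N where "N = (Re c)\<^sup>2 + (Im c)\<^sup>2"
  have N: "cnj c * c = of_real N"
    unfolding N_def by (simp add: complex_eq_iff power2_eq_square algebra_simps)
  have "of_real N * (2 * s + 2 * p - x) = 2 * (q * cnj c)"
    unfolding N[symmetric] by (metis c mult.assoc mult.commute)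
  \<comment> \<open>Energy identity: the flux at the end, tested against the solution with values \<open>1\<close>, \<open>c\<close>.\<close>
  then have "2 * (p - q * c) = 2 * p * of_real (1 + N) - 2 * q * (c + cnj c) + of_real N * (2 * s - x)"
    by (simp add: algebra_simps)
  also have "c + cnj c = of_real (2 * Re c)" by (simp add: complex_eq_iff)
  finally have "2 * Im (p - q * c) = 2 * (Im p * (1 + N)) - 4 * (Re c * Im q) + N * (2 * Im s - Im x)"
    by (simp add: complex_eq_iff)
  moreover have "N * (2 * Im s - Im x) \<le> 0"
    using assms(3,4) by (intro mult_nonneg_nonpos) (auto simp: N_def)
  moreover have "Im p * (1 + N) - 2 * (Re c * Im q) \<le> 0"
  proof -
    have "2 * \<bar>Re c\<bar> \<le> 1 + N"
    proof -
      have "0 \<le> (\<bar>Re c\<bar> - 1)\<^sup>2" by simp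
      then show ?thesis unfolding N_def by (simp add: power2_eq_square algebra_simps)
        (smt (verit) zero_le_square)
    qed
    moreover have "\<bar>Im q\<bar> \<le> - Im p" using assms(1,2) by (simp add: abs_le_iff)
    ultimately have "(2 * \<bar>Re c\<bar>) * \<bar>Im q\<bar> \<le> (1 + N) * (- Im p)"
      by (intro mult_mono) auto
    moreover have "- (2 * (Re c * Im q)) \<le> 2 * \<bar>Re c\<bar> * \<bar>Im q\<bar>"
      by (metis abs_ge_minus_self abs_mult abs_numeral mult.assoc)
    ultimately show ?thesis by (simp add: algebra_simps)
  qed
  ultimately show ?thesis by linarith
qed

text \<open>The two quantities are the responses to symmetric and antisymmetric boundary values.
  Antisymmetric values force 0 at the gluing vertex, so the second becomes the old
  \<open>pseq\<close>, the mean of the two old quantities; \<open>Im_series_bound\<close> treats the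
  first.\<close>

lemma Im_pqseq:
  assumes x: "Im x > 0"
  shows "Im (pseq n x - qseq n x) \<le> 0 \<and> Im (pseq n x + qseq n x) \<le> 0"
proof (induction n rule: less_induct)
  case (less n)
  consider "n = 0" | "n = 1" | m where "n = Suc (Suc m)" by (metis One_nat_def not0_implies_Suc)
  then show ?case
  proof cases
    case (3 m)
    define P where "P = Phi (Suc m) x"
    have IH: "Im (pseq m x - qseq m x) \<le> 0" "Im (pseq m x + qseq m x) \<le> 0"
      "Im (pseq (Suc m) x - qseq (Suc m) x) \<le> 0"
      using less.IH[of m] less.IH[of "Suc m"] 3 by auto
    have "P = 2 * (pseq (Suc m) x - qseq (Suc m) x) + 2 * pseq m x - x"
      by (simp add: P_def Phi_def)
    moreover from this have "Im P < 0" using IH x by simp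
    then have nz: "P \<noteq> 0" by auto
    ultimately have "Im (pseq m x - qseq m x * (2 * qseq m x / P)) \<le> 0"
      using IH x by (intro Im_series_bound[where s = "pseq (Suc m) x - qseq (Suc m) x" and x = x]) auto
    moreover have "pseq n x - qseq n x = pseq m x - qseq m x * (2 * qseq m x / P)"
      using nz by (simp add: 3 pseq_Phi qseq_Phi P_def[symmetric] power2_eq_square field_simps)
    ultimately have "Im (pseq n x - qseq n x) \<le> 0" by simp
    moreover have "pseq n x + qseq n x = pseq m x" by (simp add: 3 pseq_Phi qseq_Phi)
    ultimately show ?thesis using IH by auto
  qed auto
qed

lemma Im_Phi:
  assumes "Im x > 0"
  shows "Im (Phi (Suc n) x) \<le> - Im x" "Im (Phi (Suc n) x - 2 * qseq n x) \<le> - Im x"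
  using Im_pqseq[OF assms, of n] Im_pqseq[OF assms, of "Suc n"] by (auto simp: Phi_def)

lemma cmod_ge_of_Im: "Im z \<le> - t \<Longrightarrow> t \<le> cmod z"
  using abs_Im_le_cmod[of z] by linarith

lemma gpol_upper_half:
  assumes x: "Im x > 0"
  shows "gpol n x \<noteq> 0" "spol n x \<noteq> 0"
proof -
  show g: "gpol n x \<noteq> 0" for n
  proof (induction n rule: less_induct)
    case (less n)
    show ?case
    proof (cases n)
      case (Suc m)
      have a: "\<And>k. k \<le> m \<Longrightarrow> gpol k x \<noteq> 0" using less Suc by auto
      have "epol (Suc m) x \<noteq> 0" by (rule epol_nonzero) (use a in auto)
      moreover have "Phi (Suc m) x \<noteq> 0" using Im_Phi(1)[OF x, of m] x by auto
      ultimately show ?thesis using gpol_Phi(2)[of m x, OF a] a[of m] Suc by auto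
    qed simp
  qed
  have e: "epol (Suc n) x \<noteq> 0" by (rule epol_nonzero) (use g in auto)
  have "Phi (Suc n) x - 2 * qseq n x \<noteq> 0"
    using Im_Phi(2)[OF x, of n] x by (metis linorder_not_less neg_less_0_iff_less zero_complex.simps(2))
  then have "(\<Prod>k\<le>n. spol k x) \<noteq> 0" using gpol_Phi(3)[of n x, OF g] e g[of n] by (metis mult_eq_0_iff mult_zero_right mult_zero_left)
  then show "spol n x \<noteq> 0" by auto
qed

lemma pol_real_roots:
  assumes "gpol n x = 0 \<or> spol n x = 0"
  shows "Im x = 0"
proof (rule ccontr)
  assume "Im x \<noteq> 0"
  then have "Im x > 0 \<or> Im (cnj x) > 0" by auto
  moreover have "gpol n (cnj x) = cnj (gpol n x)" "spol n (cnj x) = cnj (spol n x)"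
    using pol_hom[of cnj n x] by auto
  ultimately show False using gpol_upper_half[of x n] gpol_upper_half[of "cnj x" n] assms by auto
qed

section \<open>Simplicity of the roots\<close>

lemma poly_pol:
  "poly (gpol n [:0, 1:]) a = gpol n a" "poly (spol n [:0, 1:]) a = spol n a" "poly (epol n [:0, 1:]) a = epol n a"
  using pol_hom[of "\<lambda>p. poly p a" n "[:0, 1:]"] by auto

lemma of_real_pol:
  "gpol n (complex_of_real a) = of_real (gpol n a)" "spol n (complex_of_real a) = of_real (spol n a)"
  using pol_hom[of complex_of_real n a] by auto

lemma isCont_pol:
  fixes a :: complex
  shows "isCont (gpol n) a" "isCont (spol n) a" "isCont (epol n) a"
  using poly_isCont[where p = "gpol n [:0, 1:]" and x = a] poly_isCont[where p = "spol n [:0, 1:]" and x = a]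
    poly_isCont[where p = "epol n [:0, 1:]" and x = a]
  by (simp_all add: poly_pol)

lemma isCont_theta: "isCont (theta n) (a :: complex)"
  by (induction n rule: induct_nat_012) (auto intro!: continuous_intros isCont_pol)

lemma isCont_pqseq_0:
  "isCont (pseq 0) (a :: complex)" "isCont (qseq 0) (a :: complex)"
  "isCont (pseq (Suc 0)) (a :: complex)" "isCont (qseq (Suc 0)) (a :: complex)"
proof -
  have "pseq 0 = (\<lambda>_ :: complex. 1)" "qseq 0 = (\<lambda>_ :: complex. 1)"
    "pseq (Suc 0) = (\<lambda>_ :: complex. 1)" "qseq (Suc 0) = (\<lambda>_ :: complex. 1)"
    by (simp_all add: fun_eq_iff)
  then show "isCont (pseq 0) a" "isCont (qseq 0) a" "isCont (pseq (Suc 0)) a" "isCont (qseq (Suc 0)) a"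
    by simp_all
qed

lemma isCont_pqseq:
  fixes a :: complex
  assumes "\<forall>k\<in>{1..n}. Phi k a \<noteq> 0"
  shows "isCont (pseq (Suc n)) a \<and> isCont (qseq (Suc n)) a"
  using assms
proof (induction n rule: less_induct)
  case (less n)
  note base = isCont_pqseq_0
  show ?case
  proof (cases n)
    case (Suc m)
    have 1: "isCont (pseq (Suc m)) a" "isCont (qseq (Suc m)) a"
      using less Suc by auto
    have 0: "isCont (pseq m) a" "isCont (qseq m) a"
      using base less.IH[of "m - 1"] less.prems Suc by (cases m; auto)+
    have "Phi (Suc m) a \<noteq> 0" using less.prems Suc by auto
    moreover have "isCont (Phi (Suc m)) a"
      unfolding Phi_def using 0 1 by (auto intro!: continuous_intros)
    ultimately have "isCont (\<lambda>x. qseq m x ^ 2 / Phi (Suc m) x) a"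
      using 0 by (auto intro!: continuous_intros)
    then show ?thesis
      unfolding Suc pseq_Phi[abs_def] qseq_Phi[abs_def] using 0 by (auto intro!: continuous_intros)
  qed (use base in simp)
qed

text \<open>If the root at \<open>a\<close> were double with cofactor \<open>h\<close>, the bound
  would give \<open>cmod K \<le> t * cmod h\<close> on the vertical line above \<open>a\<close>,
  hence \<open>K = 0\<close> at \<open>a\<close> in the limit.\<close>

lemma order_le_1_of_lower_bound:
  fixes p :: "complex poly" and a :: real
  assumes K: "isCont K (of_real a)" "K (of_real a) \<noteq> 0"
    and bound: "\<And>t. t > 0 \<Longrightarrow> t * cmod (K (Complex a t)) \<le> cmod (poly p (Complex a t))"
  shows "order (of_real a) p \<le> 1"
proof (rule ccontr)
  assume "\<not> ?thesis"
  then have "[:- of_real a, 1:] ^ 2 dvd p" by (simp add: order_divides)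
  then obtain h where h: "p = [:- of_real a, 1:] ^ 2 * h" by (rule dvdE)
  have le: "cmod (K (Complex a t)) \<le> t * cmod (poly h (Complex a t))" if "t > 0" for t
  proof -
    have "poly [:- of_real a, 1:] (Complex a t) = \<i> * of_real t" by (simp add: complex_eq_iff)
    then have "poly p (Complex a t) = (\<i> * of_real t) ^ 2 * poly h (Complex a t)"
      unfolding h poly_mult poly_power by simp
    then have "cmod (poly p (Complex a t)) = t * (t * cmod (poly h (Complex a t)))"
      using that by (simp add: norm_mult norm_power power2_eq_square)
    with bound[OF that] that show ?thesis by simp
  qed
  have lim: "((\<lambda>t. Complex a t) \<longlongrightarrow> of_real a) (at_right 0)"
    unfolding complex_of_real_def by (intro tendsto_Complex tendsto_intros)
  have A: "((\<lambda>t. cmod (K (Complex a t))) \<longlongrightarrow> cmod (K (of_real a))) (at_right 0)"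
    by (intro tendsto_norm isCont_tendsto_compose[OF K(1)] lim)
  have B: "((\<lambda>t. t * cmod (poly h (Complex a t))) \<longlongrightarrow> 0 * cmod (poly h (of_real a))) (at_right 0)"
    by (intro tendsto_mult tendsto_norm isCont_tendsto_compose[OF _ lim] tendsto_ident_at poly_isCont)
  have "\<forall>\<^sub>F t in at_right 0. cmod (K (Complex a t)) \<le> t * cmod (poly h (Complex a t))"
    using eventually_at_right_less[of "0 :: real"] by eventually_elim (rule le)
  from tendsto_le[OF trivial_limit_at_right_real B A this]
  have "cmod (K (of_real a)) \<le> 0" by simp
  with K(2) show False by simp
qed

lemma order_gpol: "order z (gpol n [:0, 1:] :: complex poly) \<le> 1"
proof (cases "gpol n z = 0")
  case True
  then obtain m where m: "n = Suc m" by (cases n) auto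
  obtain a where a: "z = of_real a" using pol_real_roots[of n z] True by (metis complex_of_real_def complex_surj)
  have g: "gpol k z \<noteq> 0" if "k \<le> m" for k using gpol_zero_unique(1)[OF True, of k] that m by auto
  have e: "epol n z \<noteq> 0" by (rule epol_nonzero) (use g m in auto)
  \<comment> \<open>Chosen so that \<open>gpol n x = Phi (Suc m) x * K x\<close> in the upper half
    plane; it is finite and nonzero at \<open>z\<close> because no \<open>gpol\<close> of lower
    index vanishes there.\<close>
  define K where "K x = gpol m x * epol (Suc m) x / qseq m x" for x :: complex
  have q: "qseq m z \<noteq> 0" using gpol_Phi(1)[of m z, OF g] .
  have "isCont (qseq m) z"
  proof (cases m)
    case (Suc l)
    show ?thesis unfolding Suc using isCont_pqseq[of l z] Phi_gpol(2)[of m z, OF g] Suc by auto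
  qed (simp add: isCont_pqseq_0)
  then have "isCont K z" unfolding K_def using q by (auto intro!: continuous_intros isCont_pol)
  moreover have "K z \<noteq> 0" using q g e m by (simp add: K_def)
  moreover have "t * cmod (K (Complex a t)) \<le> cmod (poly (gpol n [:0, 1:]) (Complex a t))" if t: "t > 0" for t
  proof -
    define x where "x = Complex a t"
    have x: "Im x > 0" "Im x = t" using t by (simp_all add: x_def)
    note gx = gpol_upper_half(1)[OF x(1)]
    have "gpol n x = Phi (Suc m) x * K x"
      using gpol_Phi(2)[of m x, OF gx] gpol_Phi(1)[of m x, OF gx] by (simp add: K_def m field_simps)
    moreover have "t \<le> cmod (Phi (Suc m) x)"
      using Im_Phi(1)[OF x(1), of m] x by (intro cmod_ge_of_Im) simp
    ultimately show ?thesis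
      unfolding x_def[symmetric] by (simp add: poly_pol norm_mult mult_right_mono)
  qed
  ultimately show ?thesis unfolding a by (intro order_le_1_of_lower_bound) 
qed (simp add: order_0I poly_pol)

lemma order_spol: "order z (spol n [:0, 1:] :: complex poly) \<le> 1"
proof (cases "spol n z = 0")
  case True
  obtain a where a: "z = of_real a" using pol_real_roots[of n z] True by (metis complex_of_real_def complex_surj)
  have g: "gpol k z \<noteq> 0" for k using spol_zero_unique(1)[OF True] .
  have s: "spol k z \<noteq> 0" if "k < n" for k using spol_zero_unique(2)[OF True] that by auto
  have e: "epol (Suc n) z \<noteq> 0" "theta (Suc n) z \<noteq> 0" by (rule epol_nonzero theta_nonzero; use g in auto)+
  \<comment> \<open>The factors other than \<open>spol n x\<close> on the right of
    \<open>gpol_Phi(3)\<close>; none of them vanishes at \<open>z\<close>.\<close>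
  define D where "D x = qseq n x * ((\<Prod>k<n. spol k x) * theta (Suc n) x)" for x :: complex
  define K where "K x = gpol n x * epol (Suc n) x / D x" for x :: complex
  have q: "qseq n z \<noteq> 0" using gpol_Phi(1)[of n z, OF g] .
  have D: "D z \<noteq> 0" using q s e by (simp add: D_def)
  have "isCont (qseq n) z"
  proof (cases n)
    case (Suc l)
    show ?thesis unfolding Suc using isCont_pqseq[of l z] Phi_gpol(2)[of n z, OF g] Suc by auto
  qed (simp add: isCont_pqseq_0)
  then have "isCont D z" unfolding D_def by (auto intro!: continuous_intros isCont_pol isCont_theta)
  then have "isCont K z" unfolding K_def using D by (auto intro!: continuous_intros isCont_pol)
  moreover have "K z \<noteq> 0" using D g e by (simp add: K_def)
  moreover have "t * cmod (K (Complex a t)) \<le> cmod (poly (spol n [:0, 1:]) (Complex a t))" if t: "t > 0" for t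
  \<comment> \<open>Where \<open>D\<close> vanishes, division by zero makes \<open>K\<close> zero
    and the bound is trivial.\<close>
  proof (cases "D (Complex a t) = 0")
    case False
    define x where "x = Complex a t"
    have x: "Im x > 0" "Im x = t" using t by (simp_all add: x_def)
    note gx = gpol_upper_half(1)[OF x(1)]
    have "D x * spol n x = (Phi (Suc n) x - 2 * qseq n x) * (gpol n x * epol (Suc n) x)"
      unfolding gpol_Phi(3)[of n x, OF gx] D_def by (simp add: lessThan_Suc_atMost[symmetric])
    then have "spol n x = (Phi (Suc n) x - 2 * qseq n x) * K x"
      using False by (simp add: K_def x_def field_simps)
    moreover have "t \<le> cmod (Phi (Suc n) x - 2 * qseq n x)"
      using Im_Phi(2)[OF x(1), of n] x by (intro cmod_ge_of_Im) simp
    ultimately show ?thesis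
      unfolding x_def[symmetric] by (simp add: poly_pol norm_mult mult_right_mono)
  qed (simp add: K_def)
  ultimately show ?thesis unfolding a by (intro order_le_1_of_lower_bound) 
qed (simp add: order_0I poly_pol)

section \<open>Leading coefficients and factorisation over the reals\<close>

lemma degree_lead_coeff_diff:
  fixes p q :: "'a::comm_ring_1 poly"
  assumes "degree q < degree p"
  shows "degree (p - q) = degree p" "lead_coeff (p - q) = lead_coeff p"
proof -
  show d: "degree (p - q) = degree p"
    using degree_add_eq_left[of "- q" p] assms by simp
  show "lead_coeff (p - q) = lead_coeff p"
    unfolding d using assms by (simp add: coeff_eq_0)
qed

lemma degree_numeral_mult_le: "degree (numeral k * p :: 'a::comm_ring_1 poly) \<le> degree p"
  using degree_mult_le[of "numeral k" p] by simp

text \<open>The subtracted terms of the recursions have lower degree. To see this, the induction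
  carries strict degree bounds for two consecutive levels and the degree of \<open>gpol\<close> in
  terms of \<open>spol\<close>.\<close>

lemma pol_monic:
  defines "X \<equiv> [:0, 1 :: 'a::field_char_0:]"
  shows "lead_coeff (gpol n X) = 1 \<and> lead_coeff (spol n X) = 1"
proof -
  have num: "numeral k = [:numeral k :: 'a:]" for k by (simp add: numeral_poly)
  have main: "lead_coeff (gpol (Suc n) X) = 1 \<and> lead_coeff (gpol (Suc (Suc n)) X) = 1 \<and> lead_coeff (gpol n X) = 1
    \<and> lead_coeff (spol (Suc (Suc n)) X) = 1
    \<and> epol (Suc n) X \<noteq> 0 \<and> epol (Suc (Suc n)) X \<noteq> 0 
    \<and> degree (gpol (Suc n) X) > degree (gpol n X) + degree (epol (Suc n) X)
    \<and> degree (gpol (Suc (Suc n)) X) > degree (gpol (Suc n) X) + degree (epol (Suc (Suc n)) X)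
    \<and> degree (gpol (Suc (Suc n)) X) = degree (spol (Suc (Suc n)) X) + degree (gpol n X)" for n
  proof (induction n)
    case 0
    show ?case by (simp add: X_def num power2_eq_square one_pCons)
  next
    case (Suc n)
    let ?g = "\<lambda>k. gpol k X" and ?s = "\<lambda>k. spol k X" and ?e = "\<lambda>k. epol k X"
    have nz: "?g n \<noteq> 0" "?g (Suc n) \<noteq> 0" "?g (Suc (Suc n)) \<noteq> 0" "?s (Suc (Suc n)) \<noteq> 0" using Suc by auto
    have e3: "?e (Suc (Suc (Suc n))) \<noteq> 0" using nz Suc by simp
    have de3: "degree (?e (Suc (Suc (Suc n)))) = degree (?g n) + 2 * degree (?e (Suc n))"
      using nz Suc by (simp add: degree_mult_eq degree_power_eq)
    have "degree (8 * ?e (Suc (Suc (Suc n))) * ?e (Suc (Suc n))) \<le> degree (?e (Suc (Suc (Suc n)))) + degree (?e (Suc (Suc n)))"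
      using degree_numeral_mult_le[of "num.Bit0 (num.Bit0 (num.Bit0 num.One))" "?e (Suc (Suc (Suc n))) * ?e (Suc (Suc n))"]
        degree_mult_le[of "?e (Suc (Suc (Suc n)))" "?e (Suc (Suc n))"] by (simp only: mult.assoc)
    also have "\<dots> < degree (?s (Suc (Suc n)) * ?g (Suc n))"
      using nz Suc de3 by (simp add: degree_mult_eq del: epol.simps gpol.simps spol.simps)
    finally have s: "degree (?s (Suc (Suc (Suc n)))) = degree (?s (Suc (Suc n)) * ?g (Suc n))"
      "lead_coeff (?s (Suc (Suc (Suc n)))) = lead_coeff (?s (Suc (Suc n)) * ?g (Suc n))"
      unfolding spol.simps(4)[of n X] by (rule degree_lead_coeff_diff)+
    have s1: "lead_coeff (?s (Suc (Suc (Suc n)))) = 1" using s(2) Suc by (simp add: lead_coeff_mult del: epol.simps gpol.simps spol.simps)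
    then have s0: "?s (Suc (Suc (Suc n))) \<noteq> 0" by auto
    have ds: "degree (?s (Suc (Suc (Suc n)))) = degree (?s (Suc (Suc n))) + degree (?g (Suc n))"
      using s(1) nz by (simp add: degree_mult_eq del: epol.simps gpol.simps spol.simps)
    have "degree (2 * ?g (Suc (Suc n)) * ?e (Suc (Suc (Suc n)))) \<le> degree (?g (Suc (Suc n))) + degree (?e (Suc (Suc (Suc n))))"
      using degree_numeral_mult_le[of "num.Bit0 num.One" "?g (Suc (Suc n)) * ?e (Suc (Suc (Suc n)))"]
        degree_mult_le[of "?g (Suc (Suc n))" "?e (Suc (Suc (Suc n)))"] by (simp only: mult.assoc)
    also have *: "\<dots> < degree (?s (Suc (Suc (Suc n))) * ?g (Suc n))"
      using nz s0 Suc de3 ds by (simp add: degree_mult_eq del: epol.simps gpol.simps spol.simps)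
    finally have g: "degree (?g (Suc (Suc (Suc n)))) = degree (?s (Suc (Suc (Suc n))) * ?g (Suc n))"
      "lead_coeff (?g (Suc (Suc (Suc n)))) = lead_coeff (?s (Suc (Suc (Suc n))) * ?g (Suc n))"
      unfolding gpol.simps(4)[of n X] by (rule degree_lead_coeff_diff)+
    have "lead_coeff (?g (Suc (Suc (Suc n)))) = 1"
      using g(2) s1 Suc by (simp add: lead_coeff_mult del: epol.simps gpol.simps spol.simps)
    moreover have "degree (?g (Suc (Suc (Suc n)))) = degree (?s (Suc (Suc (Suc n)))) + degree (?g (Suc n))"
      using g(1) s0 nz by (simp add: degree_mult_eq del: epol.simps gpol.simps spol.simps)
    moreover have "degree (?g (Suc (Suc n))) + degree (?e (Suc (Suc (Suc n)))) < degree (?g (Suc (Suc (Suc n))))"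
      using * g(1) by simp
    ultimately show ?case using Suc s1 e3 by blast
  qed
  have "lead_coeff (spol 0 X) = 1" "lead_coeff (spol (Suc 0) X) = 1"
    by (simp_all add: X_def num)
  then have "lead_coeff (spol n X) = 1"
    by (induction n rule: induct_nat_012) (use main in blast)+
  then show ?thesis using main[of n] by simp
qed

text \<open>\<open>P\<close> is the complex version of \<open>p\<close>. It splits into distinct
  linear factors with real roots, and comparing values at real points transfers this to
  \<open>p\<close>.\<close>

lemma root_poly_real:
  fixes p :: "real poly" and P :: "complex poly"
  assumes P: "\<And>a. poly P (of_real a) = of_real (poly p a)" "lead_coeff P = 1"
    and roots: "\<And>z. poly P z = 0 \<Longrightarrow> Im z = 0" "\<And>z. order z P \<le> 1"
  shows "p = root_poly {a. poly p a = 0}"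
proof -
  have P0: "P \<noteq> 0" using P(2) by auto
  have "order z P = 0 \<or> order z P = 1" for z using roots(2)[of z] by linarith
  then have "rsquarefree P" using P0 by (simp add: rsquarefree_def)
  from complex_poly_decompose_rsquarefree[OF this]
  have dec: "P = (\<Prod>z | poly P z = 0. [:- z, 1:])" using P(2) by simp
  have S: "{z. poly P z = 0} = of_real ` {a. poly p a = 0}"
  proof (intro equalityI subsetI)
    fix z assume z: "z \<in> {z. poly P z = 0}"
    then have "z = of_real (Re z)" using roots(1)[of z] by (simp add: complex_eq_iff)
    then show "z \<in> of_real ` {a. poly p a = 0}" using z P(1)[of "Re z"] by (metis (mono_tags) image_eqI mem_Collect_eq of_real_eq_0_iff)
  qed (use P(1) in auto)
  have "poly p a = poly (root_poly {a. poly p a = 0}) a" for a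
  proof -
    have "complex_of_real (poly p a) = (\<Prod>z\<in>of_real ` {a. poly p a = 0}. of_real a - z)"
      by (subst P(1)[symmetric], subst dec) (simp add: poly_prod S)
    also have "\<dots> = of_real (poly (root_poly {a. poly p a = 0}) a)"
      by (simp add: prod.reindex inj_on_def root_poly_def poly_prod)
    finally show ?thesis by (simp only: of_real_eq_iff)
  qed
  then show ?thesis by (intro poly_eq_poly_eq_iff[THEN iffD1] ext)
qed

section \<open>The Dirichlet spectrum\<close>

declare G.simps [simp del]

text \<open>The Dirichlet-to-Neumann matrix of \<open>G\<^sub>n\<close> at \<open>lam\<close> exists and has diagonal \<open>p\<close> and
  off-diagonal \<open>- q\<close>.\<close>

definition response :: "nat \<Rightarrow> real \<Rightarrow> real \<Rightarrow> real \<Rightarrow> bool" where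
  "response n lam p q \<longleftrightarrow>
     (\<forall>f. solves n lam f \<longrightarrow>
        laplacian (G n) f (End False) = p * f (End False) - q * f (End True) \<and>
        laplacian (G n) f (End True) = p * f (End True) - q * f (End False)) \<and>
     (\<forall>a b. \<exists>f. solves n lam f \<and> f (End False) = a \<and> f (End True) = b) \<and>
     (\<forall>f. solves n lam f \<longrightarrow> f (End False) = 0 \<longrightarrow> f (End True) = 0 \<longrightarrow> (\<forall>x\<in>verts (G n). f x = 0))"

lemma response_laplacian:
  assumes "response n lam p q" "solves n lam f"
  shows "laplacian (G n) f (End False) = p * f (End False) - q * f (End True)"
    and "laplacian (G n) f (End True) = p * f (End True) - q * f (End False)"
  using assms by (auto simp: response_def)

lemma response_exists:
  assumes "response n lam p q"
  obtains f where "solves n lam f" "f (End False) = a" "f (End True) = b"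
  using assms unfolding response_def by blast

lemma response_unique:
  assumes "response n lam p q" "solves n lam f" "f (End False) = 0" "f (End True) = 0" "x \<in> verts (G n)"
  shows "f x = 0"
  using assms by (auto simp: response_def)

lemma response_0: "response 0 lam 1 1"
proof -
  have "\<exists>f. f (End False) = a \<and> f (End True) = b" for a b :: real
    by (rule exI[of _ "case_vertex (\<lambda>t. if t then b else a) 0 (\<lambda>_ _. 0)"]) simp
  then show ?thesis by (simp add: response_def laplacian_G_0) (simp add: G.simps(1))
qed

lemma centre_1:
  assumes "solves (Suc 0) lam f"
  shows "(2 - lam) * f Centre = f (End False) + f (End True)"
  using assms by (simp add: solves_1 algebra_simps)

lemma centre_glue:
  assumes "response (Suc n) lam p1 q1" "response n lam p0 q0" "solves (Suc (Suc n)) lam f"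
  shows "(2 * (p1 - q1) + 2 * p0 - lam) * f Centre = q0 * (f (End False) + f (End True))"
proof -
  note s = assms(3)[unfolded solves_glue]
  note r1 = response_laplacian[OF assms(1), of "f \<circ> glue Big"]
  note r2 = response_laplacian[OF assms(2), of "f \<circ> glue Lft"]
  note r3 = response_laplacian[OF assms(2), of "f \<circ> glue Rgt"]
  show ?thesis using s r1 r2 r3 by (simp add: algebra_simps)
qed

text \<open>The coefficient of \<open>c\<close> may be zero. Then \<open>a = b = 0\<close> leaves
  \<open>c\<close> free, which is how new Dirichlet eigenfunctions arise.\<close>

lemma glue_exists:
  assumes r1: "response (Suc n) lam p1 q1" and r0: "response n lam p0 q0"
    and c: "(2 * (p1 - q1) + 2 * p0 - lam) * c = q0 * (a + b)"
  shows "\<exists>f. solves (Suc (Suc n)) lam f \<and> f (End False) = a \<and> f (End True) = b \<and> f Centre = c"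
proof -
  obtain fB where fB: "solves (Suc n) lam fB" "fB (End False) = c" "fB (End True) = c"
    using response_exists[OF r1] .
  obtain fL where fL: "solves n lam fL" "fL (End False) = a" "fL (End True) = c"
    using response_exists[OF r0] .
  obtain fR where fR: "solves n lam fR" "fR (End False) = c" "fR (End True) = b"
    using response_exists[OF r0] .
  define f where "f = glue_fun c (case_part fB fL fR)"
  have comp: "f \<circ> glue Big = fB" "f \<circ> glue Lft = fL" "f \<circ> glue Rgt = fR"
    unfolding f_def using fB fL fR by (simp_all add: glue_fun_comp)
  have v: "f (End False) = a" "f (End True) = b" "f Centre = c"
    using fL fR by (simp_all add: f_def)
  have "solves (Suc (Suc n)) lam f"
    unfolding solves_glue comp
    using fB fL fR v c response_laplacian[OF r1 fB(1)] response_laplacian[OF r0 fL(1)] response_laplacian[OF r0 fR(1)]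
    by (simp add: algebra_simps)
  with v show ?thesis by blast
qed

lemma glue_zero:
  assumes r1: "response (Suc n) lam p1 q1" and r0: "response n lam p0 q0"
    and s: "solves (Suc (Suc n)) lam f" and z: "f (End False) = 0" "f (End True) = 0" "f Centre = 0"
    and x: "x \<in> verts (G (Suc (Suc n)))"
  shows "f x = 0"
proof -
  have sB: "solves (Suc n) lam (f \<circ> glue Big)" and sL: "solves n lam (f \<circ> glue Lft)"
    and sR: "solves n lam (f \<circ> glue Rgt)" using s by (simp_all only: solves_glue)
  have "(f \<circ> glue Big) y = 0" if "y \<in> verts (G (Suc n))" for y
    by (rule response_unique[OF r1 sB _ _ that]) (use z in simp_all)
  moreover have "(f \<circ> glue Lft) y = 0" if "y \<in> verts (G n)" for y
    by (rule response_unique[OF r0 sL _ _ that]) (use z in simp_all)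
  moreover have "(f \<circ> glue Rgt) y = 0" if "y \<in> verts (G n)" for y
    by (rule response_unique[OF r0 sR _ _ that]) (use z in simp_all)
  ultimately show ?thesis using x by (auto simp: G.simps)
qed

lemma response_1:
  assumes "lam \<noteq> 2"
  shows "response (Suc 0) lam (1 - 1 / (2 - lam)) (1 / (2 - lam))"
proof -
  have c: "f Centre = (f (End False) + f (End True)) / (2 - lam)" if "solves (Suc 0) lam f" for f
    using centre_1[OF that] assms by (simp add: field_simps)
  have "\<exists>f. solves (Suc 0) lam f \<and> f (End False) = a \<and> f (End True) = b" for a b
    using assms by (intro exI[of _ "case_vertex (\<lambda>t. if t then b else a) ((a + b) / (2 - lam)) (\<lambda>_ _. 0)"])
      (simp add: solves_1 field_simps)
  moreover have "f x = 0" if "solves (Suc 0) lam f" "f (End False) = 0" "f (End True) = 0" "x \<in> verts (G (Suc 0))" for f x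
    using c[OF that(1)] that(2-) by (auto simp: G.simps)
  moreover have "laplacian (G (Suc 0)) f (End False) = (1 - 1 / (2 - lam)) * f (End False) - 1 / (2 - lam) * f (End True) \<and>
      laplacian (G (Suc 0)) f (End True) = (1 - 1 / (2 - lam)) * f (End True) - 1 / (2 - lam) * f (End False)"
    if "solves (Suc 0) lam f" for f
    by (simp add: laplacian_G_1 c[OF that] left_diff_distrib add_divide_distrib)
  ultimately show ?thesis unfolding response_def by blast
qed

lemma response_glue:
  assumes r1: "response (Suc n) lam p1 q1" and r0: "response n lam p0 q0"
    and P: "P = 2 * (p1 - q1) + 2 * p0 - lam" "P \<noteq> 0"
  shows "response (Suc (Suc n)) lam (p0 - q0 ^ 2 / P) (q0 ^ 2 / P)"
proof -
  have c: "f Centre = q0 * (f (End False) + f (End True)) / P" if "solves (Suc (Suc n)) lam f" for f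
    using centre_glue[OF r1 r0 that, folded P(1)] P(2) by (simp add: field_simps)
  have ex: "\<exists>f. solves (Suc (Suc n)) lam f \<and> f (End False) = a \<and> f (End True) = b" for a b
    using glue_exists[OF r1 r0, of "q0 * (a + b) / P" a b] P by auto
  have uq: "f x = 0" if "solves (Suc (Suc n)) lam f" "f (End False) = 0" "f (End True) = 0" "x \<in> verts (G (Suc (Suc n)))" for f x
    using glue_zero[OF r1 r0 that(1-3) _ that(4)] c[OF that(1)] that by simp
  have lap: "laplacian (G (Suc (Suc n))) f (End False) = (p0 - q0 ^ 2 / P) * f (End False) - q0 ^ 2 / P * f (End True) \<and>
      laplacian (G (Suc (Suc n))) f (End True) = (p0 - q0 ^ 2 / P) * f (End True) - q0 ^ 2 / P * f (End False)"
    if "solves (Suc (Suc n)) lam f" for f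
  proof -
    note s = that[unfolded solves_glue]
    have "laplacian (G (Suc (Suc n))) f (End False) = p0 * f (End False) - q0 * f Centre"
      "laplacian (G (Suc (Suc n))) f (End True) = p0 * f (End True) - q0 * f Centre"
      using response_laplacian[OF r0, of "f \<circ> glue Lft"] response_laplacian[OF r0, of "f \<circ> glue Rgt"] s
      by (simp_all add: laplacian_G_End)
    then show ?thesis
      by (simp add: c[OF that] left_diff_distrib add_divide_distrib power2_eq_square distrib_left)
  qed
  show ?thesis unfolding response_def using ex uq lap by blast
qed

lemma response_G:
  assumes "\<forall>k\<in>{1..n}. Phi k lam \<noteq> 0"
  shows "response n lam (pseq (Suc n) lam) (qseq (Suc n) lam)"
  using assms
proof (induction n rule: less_induct)
  case (less n)
  consider "n = 0" | "n = 1" | m where "n = Suc (Suc m)" by (metis One_nat_def not0_implies_Suc)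
  then show ?case
  proof cases
    case 1
    then show ?thesis using response_0 by simp
  next
    case 2
    have "lam \<noteq> 2" using less.prems 2 by (auto simp: Phi_1)
    then show ?thesis using response_1 2 by (simp add: pseq_Phi qseq_Phi Phi_1)
  next
    case 3
    have "response (Suc m) lam (pseq (Suc (Suc m)) lam) (qseq (Suc (Suc m)) lam)"
      "response m lam (pseq (Suc m) lam) (qseq (Suc m) lam)"
      using less 3 by simp_all
    moreover have "Phi (Suc (Suc m)) lam = 2 * (pseq (Suc (Suc m)) lam - qseq (Suc (Suc m)) lam) + 2 * pseq (Suc m) lam - lam"
      by (simp add: Phi_def)
    moreover have "Phi (Suc (Suc m)) lam \<noteq> 0" using less.prems 3 by auto
    ultimately show ?thesis
      unfolding 3 pseq_Phi[of "Suc m"] qseq_Phi[of "Suc m"] by (rule response_glue)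
  qed
qed

lemma centre_G:
  assumes reg: "\<forall>k\<in>{1..n}. Phi k lam \<noteq> 0" and s: "solves (Suc n) lam f"
  shows "Phi (Suc n) lam * f Centre = qseq n lam * (f (End False) + f (End True))"
proof (cases n)
  case 0
  then show ?thesis using centre_1[of lam f] s by (simp add: Phi_1)
next
  case (Suc m)
  have "response (Suc m) lam (pseq (Suc (Suc m)) lam) (qseq (Suc (Suc m)) lam)"
    "response m lam (pseq (Suc m) lam) (qseq (Suc m) lam)"
    by (rule response_G; use reg Suc in simp)+
  from centre_glue[OF this s[unfolded Suc]] show ?thesis by (simp add: Suc Phi_def)
qed

text \<open>The two outer copies carry mirror-image boundary values 0 and 1, so the fluxes at the
  ends agree. This symmetry is what \<open>gpol_zero_balanced\<close> uses.\<close>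

lemma dirichlet_exists:
  assumes reg: "\<forall>k\<in>{1..n}. Phi k lam \<noteq> 0" and P: "Phi (Suc n) lam = 0"
  shows "\<exists>f. solves (Suc n) lam f \<and> f (End False) = 0 \<and> f (End True) = 0 \<and> f Centre = 1 \<and>
    laplacian (G (Suc n)) f (End False) = laplacian (G (Suc n)) f (End True)"
proof (cases n)
  case 0
  then show ?thesis using P
    by (intro exI[of _ "case_vertex (\<lambda>_. 0) 1 (\<lambda>_ _. 0)"]) (simp add: solves_1 laplacian_G_1 Phi_1)
next
  case (Suc m)
  have r: "response (Suc m) lam (pseq (Suc (Suc m)) lam) (qseq (Suc (Suc m)) lam)"
    "response m lam (pseq (Suc m) lam) (qseq (Suc m) lam)"
    by (rule response_G; use reg Suc in simp)+
  obtain f where f: "solves (Suc (Suc m)) lam f" "f (End False) = 0" "f (End True) = 0" "f Centre = 1"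
    using glue_exists[OF r, of 1 0 0] P Suc by (auto simp: Phi_def)
  note s = f(1)[unfolded solves_glue]
  have "laplacian (G (Suc (Suc m))) f (End False) = laplacian (G (Suc (Suc m))) f (End True)"
    using response_laplacian[OF r(2), of "f \<circ> glue Lft"] response_laplacian[OF r(2), of "f \<circ> glue Rgt"] s f
    by (simp add: laplacian_G_End)
  with f show ?thesis unfolding Suc by blast
qed

lemma dirichlet_eigenfunction_G:
  "dirichlet_eigenfunction (G n) bdry lam f \<longleftrightarrow>
     (\<exists>x\<in>verts (G n). f x \<noteq> 0) \<and> f (End False) = 0 \<and> f (End True) = 0 \<and> solves n lam f"
  by (auto simp: dirichlet_eigenfunction_def solves_def bdry_def)

lemma gpol_regular:
  fixes lam :: real
  assumes "\<forall>k\<in>{1..n}. gpol k lam \<noteq> 0"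
  shows "\<forall>k\<in>{1..n}. Phi k lam \<noteq> 0" "qseq n lam \<noteq> 0" "Phi (Suc n) lam = 0 \<longleftrightarrow> gpol (Suc n) lam = 0"
proof -
  have a: "\<And>k. k \<le> n \<Longrightarrow> gpol k lam \<noteq> 0" subgoal for k using assms by (cases k) auto done
  show r: "\<forall>k\<in>{1..n}. Phi k lam \<noteq> 0" using Phi_gpol(2)[OF a] by auto
  show q: "qseq n lam \<noteq> 0" using gpol_Phi(1)[OF a] by blast
  have "epol (Suc n) lam \<noteq> 0" by (rule epol_nonzero) (use a in auto)
  then show "Phi (Suc n) lam = 0 \<longleftrightarrow> gpol (Suc n) lam = 0"
    using gpol_Phi(2)[OF a] q a[of n] by (metis mult_eq_0_iff order_refl)
qed

lemma gpol_zero_eigenfunction: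
  assumes "gpol n lam = 0"
  obtains f where "dirichlet_eigenfunction (G n) bdry lam f"
    "laplacian (G n) f (End False) = laplacian (G n) f (End True)"
proof -
  obtain m where m: "n = Suc m" using assms by (cases n) auto
  have "\<forall>k\<in>{1..m}. gpol k lam \<noteq> 0" using gpol_zero_unique(1)[OF assms] m by auto
  note r = gpol_regular[OF this]
  have "Phi (Suc m) lam = 0" using r(3) assms m by simp
  from dirichlet_exists[OF r(1) this] obtain f where f: "solves (Suc m) lam f" "f (End False) = 0" "f (End True) = 0" "f Centre = 1"
    "laplacian (G (Suc m)) f (End False) = laplacian (G (Suc m)) f (End True)" by blast
  have "\<exists>x\<in>verts (G (Suc m)). f x \<noteq> 0" using f(4) by (intro bexI[of _ Centre]) simp_all
  with f that show ?thesis by (auto simp: dirichlet_eigenfunction_G m)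
qed

text \<open>Here \<open>Phi n lam = 0\<close>, so the equation at the centre makes the sum of the
  boundary values vanish.\<close>

lemma gpol_zero_boundary:
  assumes "gpol n lam = 0" "solves n lam f" "f (End False) = f (End True)"
  shows "f (End True) = 0"
proof -
  obtain m where m: "n = Suc m" using assms by (cases n) auto
  have "\<forall>k\<in>{1..m}. gpol k lam \<noteq> 0" using gpol_zero_unique(1)[OF assms(1)] m by auto
  note r = gpol_regular[OF this]
  show ?thesis
    using centre_G[OF r(1) assms(2)[unfolded m]] r(2,3) assms m by simp
qed

lemma DirSpec_gpol_zero:
  assumes "lam \<in> DirSpec (G n) bdry"
  obtains k where "1 \<le> k" "k \<le> n" "gpol k lam = 0"
proof (rule ccontr)
  assume "\<not> thesis"
  then have "\<forall>k\<in>{1..n}. gpol k lam \<noteq> 0" using that by auto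
  from response_G[OF gpol_regular(1)[OF this]]
  have "response n lam (pseq (Suc n) lam) (qseq (Suc n) lam)" by blast
  from response_unique[OF this] show False
    using assms by (auto simp: DirSpec_def dirichlet_eigenfunction_G)
qed

lemma born_Dirichlet_iff:
  assumes "n \<ge> 1"
  shows "born (\<lambda>k. DirSpec (G k) bdry) n lam \<longleftrightarrow> gpol n lam = 0"
proof
  have *: "lam \<in> DirSpec (G k) bdry" if "gpol k lam = 0" for k
    using gpol_zero_eigenfunction[OF that] by (auto simp: DirSpec_def)
  show "gpol n lam = 0" if b: "born (\<lambda>k. DirSpec (G k) bdry) n lam"
  proof -
    obtain k where "k \<le> n" "gpol k lam = 0" using b DirSpec_gpol_zero[of lam n] unfolding born_def by blast
    with * b show ?thesis by (metis born_def le_neq_implies_less)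
  qed
  show "born (\<lambda>k. DirSpec (G k) bdry) n lam" if g: "gpol n lam = 0"
    unfolding born_def using * g gpol_zero_unique(1)[OF g] DirSpec_gpol_zero
    by (metis leD order_le_less)
qed

text \<open>An antisymmetric arrangement of two copies on \<open>G\<^sub>m\<^sub>+\<^sub>2\<close>, extended by zero to the larger graphs.\<close>

lemma gpol_zero_balanced:
  assumes "gpol m lam = 0" "m + 2 \<le> n"
  shows "\<exists>f. dirichlet_eigenfunction (G n) bdry lam f \<and>
    laplacian (G n) f (End False) + laplacian (G n) f (End True) = 0"
  using assms(2)
proof (induction n rule: dec_induct)
  case base
  obtain h where h: "dirichlet_eigenfunction (G m) bdry lam h"
    "laplacian (G m) h (End False) = laplacian (G m) h (End True)"
    using gpol_zero_eigenfunction[OF assms(1)] .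
  note h1 = h(1)[unfolded dirichlet_eigenfunction_G]
  then obtain x where x: "x \<in> verts (G m)" "h x \<noteq> 0" by blast
  \<comment> \<open>The end fluxes of \<open>h\<close> agree, so with opposite signs they cancel at
    \<open>Centre\<close>, and likewise sum to zero over the new ends.\<close>
  define f where "f = glue_fun 0 (case_part (\<lambda>_. 0) h (\<lambda>y. - 1 * h y))"
  have comp: "f \<circ> glue Big = (\<lambda>_. 0)" "f \<circ> glue Lft = h" "f \<circ> glue Rgt = (\<lambda>y. - 1 * h y)"
    unfolding f_def using h1 by (simp_all add: glue_fun_comp)
  have lap0: "laplacian H (\<lambda>_. 0) y = 0" for H :: "vertex multigraph" and y by (simp add: laplacian_def)
  have "solves (Suc (Suc m)) lam f"
    unfolding solves_glue comp laplacian_scale using h1 h(2)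
    by (simp add: lap0) (simp add: solves_def laplacian_scale[of _ "-1", simplified] laplacian_def f_def)
  moreover have "f (End b) = 0" for b using h1 by (simp add: f_def)
  moreover have "f (glue Lft x) \<noteq> 0" using x comp(2) by (metis comp_apply)
  moreover have "laplacian (G (Suc (Suc m))) f (End False) + laplacian (G (Suc (Suc m))) f (End True) = 0"
    unfolding laplacian_G_End comp laplacian_scale using h(2) by simp
  ultimately show ?case
    using glue_in_verts(2)[OF x(1)] unfolding dirichlet_eigenfunction_G
    by (metis add_2_eq_Suc')
next
  case (step n)
  then obtain h where h: "dirichlet_eigenfunction (G n) bdry lam h"
    "laplacian (G n) h (End False) + laplacian (G n) h (End True) = 0" by blast
  note h1 = h(1)[unfolded dirichlet_eigenfunction_G]
  then obtain x where x: "x \<in> verts (G n)" "h x \<noteq> 0" by blast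
  obtain l where l: "n = Suc l" using step by (cases n) auto
  \<comment> \<open>Both ends of \<open>Big\<close> meet at \<open>Centre\<close>, where their
    fluxes cancel by \<open>h(2)\<close>; no flux reaches the new ends.\<close>
  define f where "f = glue_fun 0 (case_part h (\<lambda>_. 0) (\<lambda>_. 0))"
  have comp: "f \<circ> glue Big = h" "f \<circ> glue Lft = (\<lambda>_. 0)" "f \<circ> glue Rgt = (\<lambda>_. 0)"
    unfolding f_def using h1 by (simp_all add: glue_fun_comp)
  have lap0: "laplacian H (\<lambda>_. 0) y = 0" for H :: "vertex multigraph" and y by (simp add: laplacian_def)
  have "solves (Suc (Suc l)) lam f"
    unfolding solves_glue comp using h1 h(2)
    by (simp add: lap0 l f_def) (simp add: solves_def lap0)
  moreover have "f (End b) = 0" for b using h1 by (simp add: f_def)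
  moreover have "f (glue Big x) \<noteq> 0" using x comp(1) by (metis comp_apply)
  moreover have "laplacian (G (Suc (Suc l))) f (End False) + laplacian (G (Suc (Suc l))) f (End True) = 0"
    unfolding laplacian_G_End comp by (simp add: lap0)
  ultimately show ?case
    using glue_in_verts(1)[of x l] x unfolding dirichlet_eigenfunction_G l by blast
qed

section \<open>The spectrum of the closed graphs\<close>

lemma upper_eq:
  "upper x = Base \<longleftrightarrow> x \<in> bdry" "upper x = Upper y \<longleftrightarrow> x \<notin> bdry \<and> x = y" "upper x \<noteq> Lower y"
  "lower x = Base \<longleftrightarrow> x \<in> bdry" "lower x = Lower y \<longleftrightarrow> x \<notin> bdry \<and> x = y" "lower x \<noteq> Upper y"
  by (auto simp: upper_def lower_def)

lemma laplacian_Gam: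
  "laplacian (Gam (Suc n)) F x =
     (\<Sum>y | y \<in> verts (G (Suc n)) \<and> upper y = x. laplacian (G (Suc n)) (F \<circ> upper) y)
   + (\<Sum>y | y \<in> verts (G n) \<and> lower y = x. laplacian (G n) (F \<circ> lower) y)"
proof -
  define W where "W = verts (Gam (Suc n))"
  have "finite W" "upper ` verts (G (Suc n)) \<subseteq> W" "lower ` verts (G n) \<subseteq> W"
    using finite_verts_G by (auto simp: W_def)
  moreover have "Gam (Suc n) = \<lparr>verts = W, edges = image_mset (map_uprod upper) (edges (G (Suc n)))
       + image_mset (map_uprod lower) (edges (G n))\<rparr>"
    by (simp add: W_def)
  ultimately show ?thesis
    by (simp only: laplacian_edges_add laplacian_image[OF wf_graph_G])
qed

lemma laplacian_Gam_Base:
  "laplacian (Gam (Suc n)) F Base =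
     laplacian (G (Suc n)) (F \<circ> upper) (End False) + laplacian (G (Suc n)) (F \<circ> upper) (End True)
     + laplacian (G n) (F \<circ> lower) (End False) + laplacian (G n) (F \<circ> lower) (End True)"
proof -
  have "{y. y \<in> verts (G k) \<and> y \<in> bdry} = {End False, End True}" for k
    by (auto simp: bdry_def)
  then show ?thesis
    by (simp add: laplacian_Gam upper_eq del: Gam.simps)
qed

lemma laplacian_Gam_interior:
  assumes "x \<notin> bdry"
  shows "x \<in> verts (G (Suc n)) \<Longrightarrow>
      laplacian (Gam (Suc n)) F (upper x) = laplacian (G (Suc n)) (F \<circ> upper) x"
    and "x \<in> verts (G n) \<Longrightarrow>
      laplacian (Gam (Suc n)) F (lower x) = laplacian (G n) (F \<circ> lower) x"
proof -
  have *: "upper x = Upper x" "lower x = Lower x" using assms by (auto simp: upper_eq)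
  have **: "{y. y \<in> A \<and> y \<notin> bdry \<and> y = x} = (if x \<in> A then {x} else {})" for A
    using assms by auto
  show "x \<in> verts (G (Suc n)) \<Longrightarrow>
      laplacian (Gam (Suc n)) F (upper x) = laplacian (G (Suc n)) (F \<circ> upper) x"
    and "x \<in> verts (G n) \<Longrightarrow>
      laplacian (Gam (Suc n)) F (lower x) = laplacian (G n) (F \<circ> lower) x"
    unfolding * by (simp_all add: laplacian_Gam upper_eq ** del: Gam.simps)
qed

lemma verts_Gam:
  "verts (Gam (Suc n)) = {Base} \<union> upper ` (verts (G (Suc n)) - bdry) \<union> lower ` (verts (G n) - bdry)"
proof -
  have "upper ` verts (G (Suc n)) = {Base} \<union> upper ` (verts (G (Suc n)) - bdry)"
    "lower ` verts (G n) \<subseteq> {Base} \<union> lower ` (verts (G n) - bdry)"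
    using End_in_verts[of True "Suc n"] End_in_verts[of True n]
    by (auto simp: upper_def lower_def image_iff bdry_def split: if_splits simp del: End_in_verts)
  then show ?thesis by auto
qed

lemma eigenfunction_Gam:
  "eigenfunction (Gam (Suc n)) lam F \<longleftrightarrow>
     (\<exists>x\<in>verts (Gam (Suc n)). F x \<noteq> 0) \<and> solves (Suc n) lam (F \<circ> upper) \<and> solves n lam (F \<circ> lower) \<and>
     laplacian (G (Suc n)) (F \<circ> upper) (End False) + laplacian (G (Suc n)) (F \<circ> upper) (End True)
     + laplacian (G n) (F \<circ> lower) (End False) + laplacian (G n) (F \<circ> lower) (End True) = lam * F Base"
proof -
  have "(\<forall>x\<in>verts (Gam (Suc n)). laplacian (Gam (Suc n)) F x = lam * F x) \<longleftrightarrow>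
     solves (Suc n) lam (F \<circ> upper) \<and> solves n lam (F \<circ> lower) \<and>
     laplacian (G (Suc n)) (F \<circ> upper) (End False) + laplacian (G (Suc n)) (F \<circ> upper) (End True)
     + laplacian (G n) (F \<circ> lower) (End False) + laplacian (G n) (F \<circ> lower) (End True) = lam * F Base"
    unfolding solves_def verts_Gam
    by (auto simp: laplacian_Gam_interior laplacian_Gam_Base ball_Un simp del: Gam.simps)
  then show ?thesis unfolding eigenfunction_def by blast
qed

declare Gam.simps [simp del]

lemma upper_End [simp]: "upper (End b) = Base" "lower (End b) = Base" "upper Centre = Upper Centre"
  by (auto simp: upper_def lower_def bdry_def)

lemma Gam_nonzero:
  "(\<exists>x\<in>verts (Gam (Suc n)). F x \<noteq> 0) \<longleftrightarrow>
     F Base \<noteq> 0 \<or> (\<exists>x\<in>verts (G (Suc n)). (F \<circ> upper) x \<noteq> 0) \<or> (\<exists>x\<in>verts (G n). (F \<circ> lower) x \<noteq> 0)"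
  (is "?L \<longleftrightarrow> ?R")
proof
  show "?L \<Longrightarrow> ?R" unfolding verts_Gam by auto
  show "?R \<Longrightarrow> ?L"
  proof (elim disjE bexE)
    fix x assume "x \<in> verts (G (Suc n))" "(F \<circ> upper) x \<noteq> 0"
    then show ?L unfolding verts_Gam using upper_eq(1)[of x] by (cases "x \<in> bdry") auto
  next
    fix x assume "x \<in> verts (G n)" "(F \<circ> lower) x \<noteq> 0"
    then show ?L unfolding verts_Gam using upper_eq(4)[of x] by (cases "x \<in> bdry") auto
  qed (auto simp: verts_Gam)
qed

fun join_fun :: "real \<Rightarrow> (vertex \<Rightarrow> real) \<Rightarrow> (vertex \<Rightarrow> real) \<Rightarrow> gvertex \<Rightarrow> real" where
  "join_fun c f g Base = c"
| "join_fun c f g (Upper x) = f x"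
| "join_fun c f g (Lower x) = g x"

lemma join_fun_comp:
  "f (End False) = c \<Longrightarrow> f (End True) = c \<Longrightarrow> join_fun c f g \<circ> upper = f"
  "g (End False) = c \<Longrightarrow> g (End True) = c \<Longrightarrow> join_fun c f g \<circ> lower = g"
  by (auto simp: upper_def lower_def bdry_def fun_eq_iff)

text \<open>The balance at \<open>Base\<close> is that at the gluing vertex of
  \<open>G (n + 2)\<close>, except that closing one copy of \<open>G n\<close> replaces the two
  outer copies: this turns \<open>2 * p\<close> into \<open>2 * (p - q)\<close>, hence the term
  \<open>- 2 * qseq (Suc n) lam\<close>. If \<open>F Base = 0\<close>, uniqueness on both copies
  makes \<open>F\<close> zero.\<close>

lemma Gam_regular:
  fixes lam :: real
  assumes g: "\<forall>k\<in>{1..Suc n}. gpol k lam \<noteq> 0"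
  shows "eigenfunction (Gam (Suc n)) lam F \<Longrightarrow> F Base \<noteq> 0"
    and "lam \<in> Spec (Gam (Suc n)) \<longleftrightarrow> (\<exists>k\<le>Suc n. spol k lam = 0)"
proof -
  have g': "\<forall>k\<in>{1..n}. gpol k lam \<noteq> 0" using g by auto
  have r1: "response (Suc n) lam (pseq (Suc (Suc n)) lam) (qseq (Suc (Suc n)) lam)"
    by (rule response_G) (rule gpol_regular(1)[OF g])
  have r0: "response n lam (pseq (Suc n) lam) (qseq (Suc n) lam)"
    by (rule response_G) (rule gpol_regular(1)[OF g'])
  have u: "F Base \<noteq> 0" if "eigenfunction (Gam (Suc n)) lam F" for F
    using that response_unique[OF r1, of "F \<circ> upper"] response_unique[OF r0, of "F \<circ> lower"]
    unfolding eigenfunction_Gam Gam_nonzero by auto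
  then show "eigenfunction (Gam (Suc n)) lam F \<Longrightarrow> F Base \<noteq> 0" .
  have bal: "laplacian (G (Suc n)) f (End False) + laplacian (G (Suc n)) f (End True)
      + laplacian (G n) h (End False) + laplacian (G n) h (End True) =
      (Phi (Suc (Suc n)) lam - 2 * qseq (Suc n) lam + lam) * c"
    if "solves (Suc n) lam f" "solves n lam h" "f (End False) = c" "f (End True) = c" "h (End False) = c" "h (End True) = c" for f h c
    using response_laplacian[OF r1 that(1)] response_laplacian[OF r0 that(2)] that
    by (simp add: Phi_def algebra_simps)
  have "lam \<in> Spec (Gam (Suc n)) \<longleftrightarrow> Phi (Suc (Suc n)) lam - 2 * qseq (Suc n) lam = 0"
  proof
    assume "lam \<in> Spec (Gam (Suc n))"
    then obtain F where F: "eigenfunction (Gam (Suc n)) lam F" by (auto simp: Spec_def)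
    note e = F[unfolded eigenfunction_Gam]
    have "(Phi (Suc (Suc n)) lam - 2 * qseq (Suc n) lam + lam) * F Base = lam * F Base"
      using bal[of "F \<circ> upper" "F \<circ> lower" "F Base"] e by simp
    then show "Phi (Suc (Suc n)) lam - 2 * qseq (Suc n) lam = 0"
      using u[OF F] by simp
  next
    assume z: "Phi (Suc (Suc n)) lam - 2 * qseq (Suc n) lam = 0"
    obtain f where f: "solves (Suc n) lam f" "f (End False) = 1" "f (End True) = 1"
      using response_exists[OF r1] .
    obtain h where h: "solves n lam h" "h (End False) = 1" "h (End True) = 1"
      using response_exists[OF r0] .
    have "eigenfunction (Gam (Suc n)) lam (join_fun 1 f h)"
      unfolding eigenfunction_Gam Gam_nonzero using bal[of f h 1] f h z
      by (simp add: join_fun_comp)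
    then show "lam \<in> Spec (Gam (Suc n))" by (auto simp: Spec_def)
  qed
  also have "\<dots> \<longleftrightarrow> (\<exists>k\<le>Suc n. spol k lam = 0)"
  proof -
    have a: "gpol k lam \<noteq> 0" if "k \<le> Suc n" for k using g that by (cases k) auto
    have nz: "epol (Suc (Suc n)) lam \<noteq> 0" "theta (Suc (Suc n)) lam \<noteq> 0"
      by (rule epol_nonzero theta_nonzero; use a in auto)+
    have "(Phi (Suc (Suc n)) lam - 2 * qseq (Suc n) lam) * (gpol (Suc n) lam * epol (Suc (Suc n)) lam) = 0 \<longleftrightarrow>
        qseq (Suc n) lam * ((\<Prod>k\<le>Suc n. spol k lam) * theta (Suc (Suc n)) lam) = 0"
      by (subst gpol_Phi(3)) (use a in auto)
    then have "Phi (Suc (Suc n)) lam - 2 * qseq (Suc n) lam = 0 \<longleftrightarrow> (\<Prod>k\<le>Suc n. spol k lam) = 0"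
      unfolding mult_eq_0_iff using nz a[of "Suc n"] gpol_Phi(1)[of "Suc n" lam, OF a] by blast
    then show ?thesis unfolding prod_zero_iff[OF finite_atMost] by auto
  qed
  finally show "lam \<in> Spec (Gam (Suc n)) \<longleftrightarrow> (\<exists>k\<le>Suc n. spol k lam = 0)" .
qed

lemma Spec_Gam_0: "Spec (Gam 0) = {0}"
  by (auto simp: Spec_def eigenfunction_def laplacian_def Gam.simps intro: exI[of _ "\<lambda>_. 1"])

text \<open>Computed by hand, since \<open>Gam_regular\<close> leaves open the root 2 of
  \<open>gpol 1\<close>.\<close>

lemma Spec_Gam_1: "Spec (Gam (Suc 0)) = {0, 4}"
proof -
  have e: "eigenfunction (Gam (Suc 0)) lam F \<longleftrightarrow> (F Base \<noteq> 0 \<or> F (Upper Centre) \<noteq> 0) \<and>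
      2 * F (Upper Centre) - 2 * F Base = lam * F (Upper Centre) \<and>
      2 * F Base - 2 * F (Upper Centre) = lam * F Base" for lam F
  proof -
    have "(\<exists>x\<in>verts (Gam (Suc 0)). F x \<noteq> 0) \<longleftrightarrow> F Base \<noteq> 0 \<or> F (Upper Centre) \<noteq> 0"
      unfolding Gam_nonzero by (auto simp: G.simps)
    then show ?thesis
      by (auto simp: eigenfunction_Gam solves_1 laplacian_G_0 laplacian_G_1)
  qed
  show ?thesis
  proof (intro equalityI subsetI)
    fix lam assume "lam \<in> Spec (Gam (Suc 0))"
    then obtain F where F: "eigenfunction (Gam (Suc 0)) lam F" by (auto simp: Spec_def)
    have "lam * (F Base + F (Upper Centre)) = 0" using F unfolding e by (simp add: algebra_simps)
    then consider "lam = 0" | "F (Upper Centre) = - F Base" by auto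
    then show "lam \<in> {0, 4}"
    proof cases
      case 2
      with F have "F Base \<noteq> 0" "4 * F Base = lam * F Base" unfolding e by auto
      then show ?thesis by auto
    qed auto
  next
    fix lam :: real assume "lam \<in> {0, 4}"
    then consider "lam = 0" | "lam = 4" by auto
    then show "lam \<in> Spec (Gam (Suc 0))"
    proof cases
      case 1
      then have "eigenfunction (Gam (Suc 0)) lam (\<lambda>_. 1)" unfolding e by auto
      then show ?thesis by (auto simp: Spec_def)
    next
      case 2
      then have "eigenfunction (Gam (Suc 0)) lam (join_fun 1 (\<lambda>_. -1) (\<lambda>_. 0))" unfolding e by auto
      then show ?thesis by (auto simp: Spec_def)
    qed
  qed
qed

text \<open>A root of \<open>gpol\<close> at the top level forces every eigenfunction to vanish at
  \<open>Base\<close>; one level below, the copy \<open>Big\<close>, whose ends are equal, forces it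
  to vanish at the gluing vertex. Further down, a balanced Dirichlet eigenfunction extends by zero
  to an eigenfunction vanishing at \<open>Base\<close>.\<close>

lemma zero_series_ge_2:
  assumes "zero_series (Suc (Suc n)) lam" "k \<ge> 1" "k \<le> Suc (Suc n)"
  shows "gpol k lam \<noteq> 0"
proof
  assume z: "gpol k lam = 0"
  have nz: "F Base * F (Upper Centre) \<noteq> 0" if "eigenfunction (Gam (Suc (Suc n))) lam F" for F
    using assms(1) that by (auto simp: zero_series_def)
  obtain F where F: "eigenfunction (Gam (Suc (Suc n))) lam F"
    using assms(1) by (auto simp: zero_series_def born_def Spec_def)
  note e = F[unfolded eigenfunction_Gam]
  consider "k = Suc (Suc n)" | "k = Suc n" | "k + 2 \<le> Suc (Suc n)" using assms(3) by linarith
  then show False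
  proof cases
    case 1
    have "(F \<circ> upper) (End True) = 0"
    proof (rule gpol_zero_boundary[OF z])
      show "solves k lam (F \<circ> upper)" using e 1 by blast
    qed simp
    then show False using nz[OF F] by simp
  next
    case 2
    have "(F \<circ> upper \<circ> glue Big) (End True) = 0"
    proof (rule gpol_zero_boundary[OF z])
      show "solves k lam (F \<circ> upper \<circ> glue Big)" using e 2 unfolding solves_glue by blast
    qed simp
    then show False using nz[OF F] by simp
  next
    case 3
    then obtain f where f: "dirichlet_eigenfunction (G (Suc (Suc n))) bdry lam f"
      "laplacian (G (Suc (Suc n))) f (End False) + laplacian (G (Suc (Suc n))) f (End True) = 0"
      using gpol_zero_balanced[OF z] by blast
    note f' = f(1)[unfolded dirichlet_eigenfunction_G]
    have lap0: "laplacian H (\<lambda>_. 0) y = 0" for H :: "vertex multigraph" and y by (simp add: laplacian_def)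
    have "eigenfunction (Gam (Suc (Suc n))) lam (join_fun 0 f (\<lambda>_. 0))"
      unfolding eigenfunction_Gam Gam_nonzero using f' f(2)
      by (simp add: join_fun_comp lap0 solves_def)
    from nz[OF this] show False by simp
  qed
qed

lemma zero_series_iff: "zero_series n lam \<longleftrightarrow> spol n lam = 0"
proof -
  consider "n = 0" | "n = 1" | m where "n = Suc (Suc m)" by (metis One_nat_def not0_implies_Suc)
  then show ?thesis
  proof cases
    case 1
    then show ?thesis by (simp add: zero_series_def born_def Spec_Gam_0)
  next
    case 2
    then show ?thesis by (auto simp: zero_series_def born_def Spec_Gam_0 Spec_Gam_1)
  next
    case (3 m)
    have spec: "lam \<in> Spec (Gam k) \<longleftrightarrow> (\<exists>j\<le>k. spol j lam = 0)" if "\<forall>j\<in>{1..k}. gpol j lam \<noteq> 0" for k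
      using that Gam_regular(2)[of "k - 1" lam] by (cases k) (auto simp: Spec_Gam_0)
    show ?thesis
    proof
      assume z: "zero_series n lam"
      then have g: "\<forall>j\<in>{1..n}. gpol j lam \<noteq> 0" using zero_series_ge_2 3 by auto
      have b: "lam \<in> Spec (Gam n)" "\<And>k. k < n \<Longrightarrow> lam \<notin> Spec (Gam k)" using z by (auto simp: zero_series_def born_def)
      obtain j where j: "j \<le> n" "spol j lam = 0" using b(1) spec[OF g] by auto
      have "lam \<in> Spec (Gam j)" using spec[of j] g j by auto
      then show "spol n lam = 0" using b(2)[of j] j by (cases "j = n") auto
    next
      assume s: "spol n lam = 0"
      have g: "gpol j lam \<noteq> 0" for j using spol_zero_unique(1)[OF s] .
      have "born (\<lambda>k. Spec (Gam k)) n lam"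
        unfolding born_def using s spec g spol_zero_unique(2)[OF s] by (metis le_less_trans less_irrefl order_refl)
      moreover have "F Base * F (Upper Centre) \<noteq> 0" if F: "eigenfunction (Gam n) lam F" for F
      proof -
        have B: "F Base \<noteq> 0" using Gam_regular(1)[of "Suc m" lam F] g F 3 by simp
        have reg: "\<forall>k\<in>{1..Suc m}. gpol k lam \<noteq> 0" using g by simp
        have "solves (Suc (Suc m)) lam (F \<circ> upper)" using F 3 by (simp add: eigenfunction_Gam)
        \<comment> \<open>The centre equation has right side
          \<open>qseq (Suc m) lam * (2 * F Base)\<close>, which is nonzero, so the value at the
          gluing vertex cannot be zero.\<close>
        from centre_G[OF gpol_regular(1)[OF reg] this] B gpol_regular(2)[OF reg] show ?thesis by auto
      qed
      ultimately show "zero_series n lam" using 3 by (simp add: zero_series_def)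
    qed
  qed
qed

section \<open>The recursion for the rational functions\<close>

abbreviation (input) X :: "real poly" where "X \<equiv> [:0, 1:]"

lemma gamma_eq: "gamma n = gpol n X"
proof (cases "n = 0")
  case False
  have "gpol n X = root_poly {a. poly (gpol n X) a = 0}"
    by (rule root_poly_real[where P = "gpol n [:0, 1:]"])
      (use pol_real_roots pol_monic[of n] order_gpol[of _ n] in \<open>auto simp: poly_pol of_real_pol\<close>)
  moreover have "{lam. born (\<lambda>k. DirSpec (G k) bdry) n lam} = {a. gpol n a = 0}"
    using born_Dirichlet_iff[of n] False by auto
  ultimately show ?thesis using False by (simp add: gamma_def poly_pol)
qed (simp add: gamma_def)

lemma psi_eq: "psi n = spol n X"
proof -
  have "spol n X = root_poly {a. poly (spol n X) a = 0}"
    by (rule root_poly_real[where P = "spol n [:0, 1:]"])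
      (use pol_real_roots pol_monic[of n] order_spol[of _ n] in \<open>auto simp: poly_pol of_real_pol\<close>)
  then show ?thesis
    by (simp add: psi_def zero_series_iff poly_pol)
qed

text \<open>Unfolds \<open>epol n x = gpol (n - 3) x * epol (n - 2) x ^ 2\<close>: the first factor
  is the term \<open>j = 0\<close>, and squaring raises the exponents \<open>2 ^ j\<close> to
  \<open>2 ^ Suc j\<close>.\<close>

lemma epol_prod:
  assumes "n \<ge> 3"
  shows "epol n x = (\<Prod>j | 2 * j + 4 \<le> n. gpol (n - 2 * j - 3) x ^ (2 ^ j))"
  using assms
proof (induction n rule: less_induct)
  case (less n)
  consider "n = 3" | "n = 4" | m where "n = m + 5"
    using less.prems by (metis add.commute le_add_diff_inverse less_Suc_eq_le not_less numeral_eq_Suc pred_numeral_simps(2,3) semiring_norm(26-28) antisym)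
  then show ?case
  proof cases
    case 1
    then show ?thesis by (simp add: numeral_3_eq_3)
  next
    case 2
    have "{j. 2 * j + 4 \<le> n} = {0}" using 2 by auto
    then show ?thesis using 2 by (simp add: eval_nat_numeral)
  next
    case (3 m)
    define S where "S = {j. 2 * j + 4 \<le> m + 3}"
    have fin: "finite S" by (rule finite_subset[of _ "{..m}"]) (auto simp: S_def)
    have S: "{j. 2 * j + 4 \<le> n} = insert 0 (Suc ` S)"
    proof -
      have "j \<in> insert 0 (Suc ` S) \<longleftrightarrow> 2 * j + 4 \<le> n" for j
        by (cases j) (auto simp: S_def 3)
      then show ?thesis by blast
    qed
    have "epol n x = gpol (m + 2) x * epol (m + 3) x ^ 2"
      unfolding 3 by (simp add: eval_nat_numeral)
    also have "epol (m + 3) x = (\<Prod>j\<in>S. gpol (m + 3 - 2 * j - 3) x ^ (2 ^ j))"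
      unfolding S_def by (rule less.IH) (use 3 in auto)
    also have "\<dots> ^ 2 = (\<Prod>j\<in>S. gpol (n - 2 * Suc j - 3) x ^ (2 ^ Suc j))"
      unfolding prod_power_distrib 3
      by (intro prod.cong refl) (simp add: power_mult[symmetric] mult.commute)
    finally show ?thesis
      unfolding S using fin by (simp add: prod.reindex 3)
  qed
qed

lemma eta_eq:
  assumes "n \<ge> 3"
  shows "eta n = gpol (n - 1) X * epol n X"
  by (simp add: eta_def gamma_eq epol_prod[OF assms])

lemma pol_nonzero: "gpol n X \<noteq> 0" "spol n X \<noteq> 0" "epol n X \<noteq> 0" "theta n X \<noteq> 0"
proof -
  show g: "gpol n X \<noteq> 0" "spol n X \<noteq> 0" for n
    using pol_monic[of n, where ?'a = real] by auto
  show "epol n X \<noteq> 0" "theta n X \<noteq> 0" by (intro epol_nonzero theta_nonzero g)+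
qed

lemma zeta_nonzero: "n \<ge> 3 \<Longrightarrow> zeta n \<noteq> 0"
  by (simp add: zeta_def gamma_eq eta_eq pol_nonzero)

lemma Z_nonzero: "Z n \<noteq> 0"
  by (simp add: Z_def gamma_eq psi_eq pol_nonzero)

lemma to_fract_numeral: "to_fract (numeral k) = numeral k"
proof -
  have "to_fract (of_nat n) = of_nat n" for n by (induction n) simp_all
  from this[of "numeral k"] show ?thesis by simp
qed

lemma Z_zeta:
  assumes "n \<ge> 3"
  shows "Z n = 1 + 2 / zeta n"
proof -
  have "Z n = to_fract (gpol n X + 2 * gpol (n - 1) X * epol n X) / to_fract (gpol n X)"
    unfolding Z_def gamma_eq psi_eq using gpol_gluing[of n X] assms by simp
  then show ?thesis
    using assms by (simp add: zeta_def gamma_eq eta_eq pol_nonzero to_fract_numeral field_simps)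
qed

lemma zeta_minus_2:
  assumes "n \<ge> 3"
  shows "zeta n - 2 = to_fract (gpol n X - 2 * gpol (n - 1) X * epol n X) / to_fract (gpol (n - 1) X * epol n X)"
  using assms by (simp add: zeta_def gamma_eq eta_eq pol_nonzero to_fract_numeral field_simps)

text \<open>\<open>gpol_prod\<close> displays the numerator as a product of nonzero polynomials.
  This justifies the division in \<open>Z_recursion\<close>.\<close>

lemma zeta_neq_2:
  assumes "n \<ge> 3"
  shows "zeta n - 2 \<noteq> 0"
proof -
  have "gpol n X - 2 * gpol (n - 1) X * epol n X \<noteq> 0"
    using assms gpol_prod[of n X] by (simp add: pol_nonzero)
  then show ?thesis unfolding zeta_minus_2[OF assms]
    by (simp only: divide_eq_0_iff to_fract_eq_0_iff mult_eq_0_iff) (simp add: pol_nonzero)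
qed

lemma zeta_recursion:
  assumes "n \<ge> 5"
  shows "zeta n - 2 = Z (n - 1) * (zeta (n - 2) ^ 2 - 4)"
proof -
  obtain m where m: "n = m + 5" using assms by (metis add.commute le_Suc_ex)
  define a b c e where "a = to_fract (gpol (m + 4) X)" and "b = to_fract (gpol (m + 3) X)"
    and "c = to_fract (gpol (m + 2) X)" and "e = to_fract (epol (m + 3) X)"
  define s where "s = to_fract (spol (m + 4) X)"
  have nz: "a \<noteq> 0" "b \<noteq> 0" "c \<noteq> 0" "e \<noteq> 0" by (simp_all add: a_def b_def c_def e_def pol_nonzero)
  have e5: "epol (m + 5) X = gpol (m + 2) X * epol (m + 3) X ^ 2" by (simp add: eval_nat_numeral)
  have "gpol n X - 2 * gpol (n - 1) X * epol n X = spol (m + 4) X * (gpol (m + 3) X ^ 2 - 4 * (gpol (m + 2) X * epol (m + 3) X) ^ 2)"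
  proof -
    have "m + 3 + 2 = m + 5" "m + 3 + 1 = m + 4" "m + 3 - 1 = m + 2" "m + 5 - 1 = m + 4" by simp_all
    with gpol_factor[of "m + 3" X] show ?thesis unfolding m by (simp add: add.commute)
  qed
  then have 1: "zeta n - 2 = s * (b ^ 2 - 4 * (c * e) ^ 2) / (a * (c * e ^ 2))"
    using zeta_minus_2[of n] by (simp add: m e5 a_def b_def c_def e_def s_def to_fract_numeral power2_eq_square add.commute)
  have 2: "Z (n - 1) = s * c / a"
    by (simp add: Z_def gamma_eq psi_eq m a_def c_def s_def add.commute)
  have 3: "zeta (n - 2) = b / (c * e)"
    by (simp add: zeta_def gamma_eq eta_eq m b_def c_def e_def add.commute)
  show ?thesis unfolding 1 2 3 using nz by (simp add: field_simps power2_eq_square)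
qed

text \<open>In terms of \<open>z\<close>, \<open>w\<close> and \<open>Y\<close> the factors on the
  right are \<open>1 / Y\<close>, \<open>2 / (w + 2)\<close>, \<open>Y * (w^2 - 4) / z\<close> and
  \<open>1 / (w - 2)\<close>; their product is \<open>2 / z\<close>.\<close>

lemma Z_recursion:
  assumes "n \<ge> 5"
  shows "Z n - 1 = 1 / Z (n - 1) * (1 - 1 / Z (n - 2)) * (1 - 2 / zeta n) * (1 / (zeta (n - 2) - 2))"
proof -
  define z w Y where "z = zeta n" and "w = zeta (n - 2)" and "Y = Z (n - 1)"
  have nz: "z \<noteq> 0" "w \<noteq> 0" "w - 2 \<noteq> 0" "Y \<noteq> 0"
    using zeta_nonzero[of n] zeta_nonzero[of "n - 2"] zeta_neq_2[of "n - 2"] Z_nonzero assms by (auto simp: z_def w_def Y_def)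
  have Zw: "Z (n - 2) = (w + 2) / w" using Z_zeta[of "n - 2"] assms nz by (simp add: w_def field_simps)
  then have w2: "w + 2 \<noteq> 0" using Z_nonzero[of "n - 2"] by auto
  have "1 - 2 / z = Y * ((w + 2) * (w - 2)) / z"
    using zeta_recursion[OF assms] nz by (simp add: z_def w_def Y_def field_simps power2_eq_square)
  moreover have "1 - 1 / Z (n - 2) = 2 / (w + 2)" unfolding Zw using nz w2 by (simp add: field_simps)
  moreover have "Z n - 1 = 2 / z" using Z_zeta[of n] assms by (simp add: z_def)
  ultimately show ?thesis unfolding z_def[symmetric] w_def[symmetric] Y_def[symmetric]
    using nz w2 by simp (simp add: field_simps)
qed

(* The value lambda * (lambda - 4) belongs to the 0-series up to level 1: since 0 is the eigenvalue
   of the one-vertex graph Gam 0, it is born at level 0 and is a root of psi 0, not of psi 1. *)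
theorem theorem4p14:
  shows "(\<forall>n\<ge>5. Z n - 1 =
             1 / Z (n - 1) * (1 - 1 / Z (n - 2)) * (1 - 2 / zeta n) * (1 / (zeta (n - 2) - 2)))
       \<and> Z 3 = to_fract ([:-8, 24, -10, 1:] * [:-2, 1:]) / to_fract [:8, -44, 42, -12, 1:]
       \<and> Z 4 = to_fract ([:-16, 136, -192, 88, -16, 1:] * [:4, -6, 1:])
                / to_fract [:-32, 448, -1344, 1508, -756, 186, -22, 1:]
       \<and> psi 1 = [:-4, 1:]
       \<and> psi 0 * psi 1 = [:0, 1:] * [:-4, 1:]
       \<and> root_poly (Spec (Gam 1)) = [:0, 1:] * [:-4, 1:]
       \<and> psi 2 = [:8, -8, 1:]"
proof (intro conjI allI impI)
  have g: "gpol 1 X = [:-2, 1:]" "gpol 2 X = [:4, -6, 1:]"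
    and s: "spol 2 X = [:8, -8, 1:]"
    by (simp_all add: numeral_2_eq_2 numeral_poly power2_eq_square)
  have s3: "spol 3 X = [:-8, 24, -10, 1:]" and e3: "epol 3 X = 1"
    using g s by (simp_all add: eval_nat_numeral numeral_poly one_pCons)
  have g3: "gpol 3 X = [:8, -44, 42, -12, 1:]"
    using g s3 e3 by (simp add: eval_nat_numeral numeral_poly one_pCons del: spol.simps epol.simps gpol.simps(1-3))
  have s4: "spol 4 X = [:-16, 136, -192, 88, -16, 1:]" and e4: "epol 4 X = [:-2, 1:]"
    using g s3 e3 by (simp_all add: eval_nat_numeral numeral_poly one_pCons)
  have g4: "gpol 4 X = [:-32, 448, -1344, 1508, -756, 186, -22, 1:]"
    using g g3 s4 e4 by (simp add: eval_nat_numeral numeral_poly one_pCons)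
  show "Z 3 = to_fract ([:-8, 24, -10, 1:] * [:-2, 1:]) / to_fract [:8, -44, 42, -12, 1:]"
    unfolding Z_def gamma_eq psi_eq s3 g3 using g(1) by simp
  show "Z 4 = to_fract ([:-16, 136, -192, 88, -16, 1:] * [:4, -6, 1:])
                / to_fract [:-32, 448, -1344, 1508, -756, 186, -22, 1:]"
    unfolding Z_def gamma_eq psi_eq s4 g4 using g(2) by simp
  show "psi 1 = [:-4, 1:]" "psi 0 * psi 1 = [:0, 1:] * [:-4, 1:]"
    by (simp_all add: psi_eq numeral_poly)
  show "root_poly (Spec (Gam 1)) = [:0, 1:] * [:-4, 1:]"
    by (simp add: Spec_Gam_1 root_poly_def)
  show "psi 2 = [:8, -8, 1:]" by (simp add: psi_eq s)
qed (rule Z_recursion)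

end
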